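(* If every geodesic on $\Sigma_\Gamma$ intersects the open ball $B(\pi(x),\rho)$ and $\rho<\operatorname{inj}(\Gamma,x)$, then $S^+(\ell,\rho,x)$ is a Delone set. Moreover, if $S^+(\ell,\rho,x)$ is Delone, then it is chaotic.
   Context: $\mathbb{D}=\{z\in\mathbb{C}:|z|<1\}$ with hyperbolic metric $d$ induced by $ds=2|dz|/(1-|z|^2)$; geodesics are parametrised with unit speed and the normal bundle of an oriented geodesic is oriented by the standard orientation of $\mathbb{D}$ and that of the geodesic. Standing setting: $\Gamma$ is a cocompact Fuchsian group (discrete subgroup of orientation-preserving isometries of $\mathbb{D}$ with compact quotient) with fundamental domain $\tau$ a hyperbolic polygon whose side-pairing generators are none of them their own inverse; $\Sigma_\Gamma=\Gamma\backslash\mathbb{D}$ with quotient map $\pi$ and induced metric; $\ell$ is a geodesic in $\mathbb{D}$ with unit-speed parametrisation $\kappa_\ell$ such that the image of $\{(\kappa_\ell(t),\kappa_\ell'(t))\}$ in $\operatorname{ST}(\Sigma_\Gamma)$ is a dense orbit of the geodesic flow; $x\in\tau^\circ$ and $\rho>0$. $\operatorname{inj}(\Gamma,x)=\frac12\inf\{d(y,z):y,z\in\Gamma(x),y\ne z\}$. For a geodesic $k$ with unit-speed parametrisation $\kappa$: $\overline{\mathcal{N}(k,\rho)}^+$ is the union of $\{y:d(y,k)<\rho\}$ with the component of its boundary on the positive side of $k$; $p_k$ is orthogonal projection onto $k$; $S^+(k,\rho,x)=\kappa^{-1}(p_k(\Gamma(x)\cap\overline{\mathcal{N}(k,\rho)}^+))\subseteq\mathbb{R}$.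 A set $S\subseteq\mathbb{R}$ is $(\varepsilon,\delta)$-Delone if every point of $\mathbb{R}$ is within $\varepsilon$ of $S$ and distinct points of $S$ are at distance $\ge\delta$; Delone means $(\varepsilon,\delta)$-Delone for some $\varepsilon,\delta>0$. For $r>0$, $(S,S')\in N_r$ means $S\cap(-r,r)\subseteq S'+(-1/r,1/r)$ and $S'\cap(-r,r)\subseteq S+(-1/r,1/r)$. The set $\operatorname{Del}_{\varepsilon,\delta}$ of $(\varepsilon,\delta)$-Delone subsets of $\mathbb{R}$ carries the local rubber topology, in which $\{S':(S,S')\in N_r\}$, $r>0$, form a neighbourhood base at $S$, and $\mathbb{R}$ acts by translation $S\mapsto S-v$. $S$ is periodic if its orbit $[S]=S+\mathbb{R}$ is compact; aperiodic if $S-v\ne S$ for all $v\ne0$; almost chaotic if the union of periodic orbits is dense in the closure $\overline{[S]}$; chaotic if almost chaotic and aperiodic. *)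

theory Defs
  imports "HOL-Analysis.Analysis"
begin

definition disc :: "complex set" where
  "disc = ball 0 1"

text \<open>Distance induced by ds = 2|dz|/(1-|z|^2).\<close>
definition hdist :: "complex \<Rightarrow> complex \<Rightarrow> real" where
  "hdist z w = arcosh (1 + 2 * (cmod (z - w))\<^sup>2 / ((1 - (cmod z)\<^sup>2) * (1 - (cmod w)\<^sup>2)))"

text \<open>Orientation-preserving isometries of the disc: z |-> (a z + b)/(conj b z + conj a),
  |a|^2 - |b|^2 = 1, extended by the identity outside the disc (so that composition and
  inverses are exact equalities of functions).\<close>
definition mob :: "complex \<Rightarrow> complex \<Rightarrow> complex \<Rightarrow> complex" where
  "mob a b = (\<lambda>z. if z \<in> disc then (a * z + b) / (cnj b * z + cnj a) else z)"

definition isom :: "(complex \<Rightarrow> complex) \<Rightarrow> bool" where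
  "isom g \<longleftrightarrow> (\<exists>a b. (cmod a)\<^sup>2 - (cmod b)\<^sup>2 = 1 \<and> g = mob a b)"

text \<open>Standard unit-speed parametrisation of the real diameter, oriented from -1 to 1.\<close>
definition std_geod :: "real \<Rightarrow> complex" where
  "std_geod t = complex_of_real (tanh (t / 2))"

definition unit_geodesic :: "(real \<Rightarrow> complex) \<Rightarrow> bool" where
  "unit_geodesic \<kappa> \<longleftrightarrow> (\<forall>t. \<kappa> t \<in> disc) \<and> (\<forall>s t. hdist (\<kappa> s) (\<kappa> t) = \<bar>s - t\<bar>)"

text \<open>Open positive side of an oriented geodesic: image of the upper half of the disc under the
  orientation-preserving isometry carrying the standard geodesic to it (the positive normal is
  i times the tangent).\<close>
definition pos_side :: "(real \<Rightarrow> complex) \<Rightarrow> complex set" where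
  "pos_side \<kappa> = {y. \<exists>M w. isom M \<and> (\<forall>t. \<kappa> t = M (std_geod t)) \<and> w \<in> disc \<and> Im w > 0 \<and> y = M w}"

definition closed_halfplane :: "complex set \<Rightarrow> bool" where
  "closed_halfplane H \<longleftrightarrow> (\<exists>M. isom M \<and> H = M ` {w \<in> disc. Im w \<ge> 0})"

definition hyp_polygon :: "complex set \<Rightarrow> bool" where
  "hyp_polygon P \<longleftrightarrow> compact P \<and> P \<subseteq> disc \<and> interior P \<noteq> {} \<and>
     (\<exists>\<H>. finite \<H> \<and> \<H> \<noteq> {} \<and> (\<forall>H\<in>\<H>. closed_halfplane H) \<and> P = \<Inter>\<H>)"

definition fuchsian :: "(complex \<Rightarrow> complex) set \<Rightarrow> bool" where
  "fuchsian \<Gamma> \<longleftrightarrow> (\<forall>g\<in>\<Gamma>. isom g) \<and> id \<in> \<Gamma> \<and> (\<forall>g\<in>\<Gamma>. \<forall>h\<in>\<Gamma>. g \<circ> h \<in> \<Gamma>)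
     \<and> (\<forall>g\<in>\<Gamma>. \<exists>h\<in>\<Gamma>. g \<circ> h = id \<and> h \<circ> g = id)
     \<comment> \<open>discreteness in PSU(1,1): the identity is isolated\<close>
     \<and> (\<exists>e>0. \<forall>a b. (cmod a)\<^sup>2 - (cmod b)\<^sup>2 = 1 \<and> mob a b \<in> \<Gamma> \<and> mob a b \<noteq> id \<longrightarrow>
              min (cmod (a - 1)) (cmod (a + 1)) + cmod b \<ge> e)"

definition cocompact :: "(complex \<Rightarrow> complex) set \<Rightarrow> bool" where
  "cocompact \<Gamma> \<longleftrightarrow> (\<exists>K. compact K \<and> K \<subseteq> disc \<and> (\<Union>g\<in>\<Gamma>. g ` K) = disc)"

definition fundamental_domain :: "(complex \<Rightarrow> complex) set \<Rightarrow> complex set \<Rightarrow> bool" where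
  "fundamental_domain \<Gamma> \<tau> \<longleftrightarrow> closed \<tau> \<and> \<tau> \<subseteq> disc \<and> (\<Union>g\<in>\<Gamma>. g ` \<tau>) = disc \<and>
     (\<forall>g\<in>\<Gamma>. g \<noteq> id \<longrightarrow> interior \<tau> \<inter> g ` (interior \<tau>) = {})"

text \<open>Side-pairing elements: non-identity g such that tau and g(tau) share a side.\<close>
definition side_pairings :: "(complex \<Rightarrow> complex) set \<Rightarrow> complex set \<Rightarrow> (complex \<Rightarrow> complex) set" where
  "side_pairings \<Gamma> \<tau> = {g\<in>\<Gamma>. g \<noteq> id \<and> infinite (\<tau> \<inter> g ` \<tau>)}"

definition orbit :: "(complex \<Rightarrow> complex) set \<Rightarrow> complex \<Rightarrow> complex set" where
  "orbit \<Gamma> x = (\<lambda>g. g x) ` \<Gamma>"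

definition inj_rad :: "(complex \<Rightarrow> complex) set \<Rightarrow> complex \<Rightarrow> real" where
  "inj_rad \<Gamma> x = (1/2) * Inf {hdist y z | y z. y \<in> orbit \<Gamma> x \<and> z \<in> orbit \<Gamma> x \<and> y \<noteq> z}"

text \<open>Unit tangent bundle of the disc and density of the projection of a geodesic orbit in the
  unit tangent bundle of the quotient (= density of its Gamma-saturation upstairs).\<close>
definition unit_tangent :: "(complex \<times> complex) set" where
  "unit_tangent = {(z, v). z \<in> disc \<and> 2 * cmod v / (1 - (cmod z)\<^sup>2) = 1}"

definition dense_geodesic :: "(complex \<Rightarrow> complex) set \<Rightarrow> (real \<Rightarrow> complex) \<Rightarrow> bool" where
  "dense_geodesic \<Gamma> \<kappa> \<longleftrightarrow>
     unit_tangent \<subseteq> closure {(g (\<kappa> t), deriv g (\<kappa> t) * vector_derivative \<kappa> (at t)) | g t. g \<in> \<Gamma>}"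

definition dist_geod :: "complex \<Rightarrow> (real \<Rightarrow> complex) \<Rightarrow> real" where
  "dist_geod y \<kappa> = Inf (range (\<lambda>s. hdist y (\<kappa> s)))"

definition nbhd_plus :: "(real \<Rightarrow> complex) \<Rightarrow> real \<Rightarrow> complex set" where
  "nbhd_plus \<kappa> \<rho> = {y \<in> disc. dist_geod y \<kappa> < \<rho>} \<union> {y \<in> disc. dist_geod y \<kappa> = \<rho> \<and> y \<in> pos_side \<kappa>}"

text \<open>kappa^{-1}(p_k(Gamma(x) \<inter> N^+)); p_k(y) is the (unique) nearest point of k to y.\<close>
definition S_plus :: "(complex \<Rightarrow> complex) set \<Rightarrow> (real \<Rightarrow> complex) \<Rightarrow> real \<Rightarrow> complex \<Rightarrow> real set" where
  "S_plus \<Gamma> \<kappa> \<rho> x = {t. \<exists>y \<in> orbit \<Gamma> x \<inter> nbhd_plus \<kappa> \<rho>. hdist y (\<kappa> t) = dist_geod y \<kappa>}"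

definition delone_with :: "real \<Rightarrow> real \<Rightarrow> real set \<Rightarrow> bool" where
  "delone_with \<epsilon> \<delta> S \<longleftrightarrow> (\<forall>y. \<exists>s\<in>S. \<bar>y - s\<bar> \<le> \<epsilon>) \<and> (\<forall>s\<in>S. \<forall>s'\<in>S. s \<noteq> s' \<longrightarrow> \<bar>s - s'\<bar> \<ge> \<delta>)"

definition delone :: "real set \<Rightarrow> bool" where
  "delone S \<longleftrightarrow> (\<exists>\<epsilon>>0. \<exists>\<delta>>0. delone_with \<epsilon> \<delta> S)"

definition Del :: "real \<Rightarrow> real \<Rightarrow> real set set" where
  "Del \<epsilon> \<delta> = {S. delone_with \<epsilon> \<delta> S}"

definition N_rel :: "real \<Rightarrow> real set \<Rightarrow> real set \<Rightarrow> bool" where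
  "N_rel r S S' \<longleftrightarrow> S \<inter> {-r<..<r} \<subseteq> {s + u | s u. s \<in> S' \<and> \<bar>u\<bar> < 1/r}
                  \<and> S' \<inter> {-r<..<r} \<subseteq> {s + u | s u. s \<in> S \<and> \<bar>u\<bar> < 1/r}"

definition rubber :: "real \<Rightarrow> real \<Rightarrow> real set topology" where
  "rubber \<epsilon> \<delta> = topology (\<lambda>U. U \<subseteq> Del \<epsilon> \<delta> \<and>
      (\<forall>S\<in>U. \<exists>r>0. {S' \<in> Del \<epsilon> \<delta>. N_rel r S S'} \<subseteq> U))"

definition translate :: "real set \<Rightarrow> real \<Rightarrow> real set" where
  "translate S v = (\<lambda>s. s - v) ` S"

definition orb :: "real set \<Rightarrow> real set set" where
  "orb S = range (translate S)"

definition periodic_in :: "real \<Rightarrow> real \<Rightarrow> real set \<Rightarrow> bool" where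
  "periodic_in \<epsilon> \<delta> S \<longleftrightarrow> S \<in> Del \<epsilon> \<delta> \<and> compactin (rubber \<epsilon> \<delta>) (orb S)"

definition aperiodic :: "real set \<Rightarrow> bool" where
  "aperiodic S \<longleftrightarrow> (\<forall>v. v \<noteq> 0 \<longrightarrow> translate S v \<noteq> S)"

definition almost_chaotic_in :: "real \<Rightarrow> real \<Rightarrow> real set \<Rightarrow> bool" where
  "almost_chaotic_in \<epsilon> \<delta> S \<longleftrightarrow>
     (let C = rubber \<epsilon> \<delta> closure_of (orb S) in
        C \<subseteq> rubber \<epsilon> \<delta> closure_of (\<Union>{orb T | T. T \<in> C \<and> periodic_in \<epsilon> \<delta> T}))"

definition chaotic :: "real set \<Rightarrow> bool" where
  "chaotic S \<longleftrightarrow> (\<exists>\<epsilon>>0. \<exists>\<delta>>0. S \<in> Del \<epsilon> \<delta> \<and> almost_chaotic_in \<epsilon> \<delta> S) \<and> aperiodic S"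

end

theory Submission
  imports Defs
begin

text \<open>
  Oriented geodesics are parametrised by \<open>SU(1,1)\<close>: every unit-speed geodesic is the image of the real
  diameter under some \<open>p\<close>. In the hyperboloid coordinates of \<open>p\<inverse>(y)\<close> the signed distance of \<open>y\<close> to the
  geodesic and its projection are explicit and depend continuously on \<open>p\<close>, so \<open>S\<^sup>+\<close> can only change
  through orbit points at distance exactly \<open>\<rho>\<close>. Moving the geodesic slightly towards its positive side
  puts these points strictly on the correct side of the boundary; hence every \<open>S\<^sup>+(k)\<close> is approximated on
  any window by \<open>S\<^sup>+(k')\<close> for all \<open>k'\<close> in some open set. Translates of the dense geodesic and, by the
  closing lemma, closed geodesics enter this open set. The former shows that all \<open>S\<^sup>+(k)\<close> lie in the
  orbit closure of \<open>S\<^sup>+(\<ell>)\<close>, the latter that the periodic ones are dense in it. A period of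
  \<open>S\<^sup>+(\<ell>)\<close> would be a period of all \<open>S\<^sup>+(k)\<close>, which fails for the geodesics through \<open>x\<close>.
  That \<open>S\<^sup>+(\<ell>)\<close> is Delone follows from compactness (relative density) and from the triangle
  inequality (separation by \<open>2 (inj(\<Gamma>, x) - \<rho>)\<close>).
\<close>

section \<open>The group SU(1,1) acting on the disc\<close>

text \<open>Working with frames in SU(1,1) instead of geodesics turns both symmetries into
  multiplications. A lift of an element of \<Gamma> on the left only permutes the orbit and leaves
  \<open>feet\<close> unchanged; \<open>boost v\<close> on the right is the geodesic flow and shifts
  \<open>feet\<close> by -v. Density of the geodesic becomes density of the frames
  \<open>q \<odot> (p \<odot> boost t)\<close>, all of which have translates of one and the same set
  as their feet. The obstacle is that \<open>feet\<close> is not continuous in the frame, because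
  the strip is half-open. Neither the dense orbit nor the closed geodesics can be steered to one
  side of a given frame, so a full neighbourhood of good frames is required. It exists around a
  pushed frame p1 near the given one, and every approximation is carried out there. The Delone
  constants of the set of the dense geodesic are inherited by the sets of all other frames, so a
  single space \<open>Del\<close> serves throughout.\<close>

definition SU11 :: "(complex \<times> complex) set" where
  "SU11 = {p. (cmod (fst p))\<^sup>2 - (cmod (snd p))\<^sup>2 = 1}"

text \<open>The pair (a, b) is the first row of the matrix with second row (cnj b, cnj a); this is
  the matrix product, and \<open>su_inv\<close> is the adjugate.\<close>

definition su_mult :: "complex \<times> complex \<Rightarrow> complex \<times> complex \<Rightarrow> complex \<times> complex"  (infixl "\<odot>" 70) where
  "p \<odot> q = (fst p * fst q + snd p * cnj (snd q), fst p * snd q + snd p * cnj (fst q))"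

definition su_inv :: "complex \<times> complex \<Rightarrow> complex \<times> complex" where
  "su_inv p = (cnj (fst p), - snd p)"

definition su_one :: "complex \<times> complex" where
  "su_one = (1, 0)"

text \<open>The automorphy factor: \<open>act p\<close> has derivative 1 / (den p z)^2, and
  \<open>den_mult\<close> is the cocycle rule.\<close>

definition den :: "complex \<times> complex \<Rightarrow> complex \<Rightarrow> complex" where
  "den p z = cnj (snd p) * z + cnj (fst p)"

definition act :: "complex \<times> complex \<Rightarrow> complex \<Rightarrow> complex" where
  "act p z = (fst p * z + snd p) / den p z"

text \<open>The operator norm of the matrix, expressed by its first row. It is also applied to
  differences of group elements.\<close>

definition su_norm :: "complex \<times> complex \<Rightarrow> real" where
  "su_norm p = cmod (fst p) + cmod (snd p)"

text \<open>Half arguments because of the factor 2 in the metric: \<open>boost t\<close> moves 0 to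
  tanh (t/2), at distance |t|.\<close>

definition boost :: "real \<Rightarrow> complex \<times> complex" where
  "boost t = (of_real (cosh (t/2)), of_real (sinh (t/2)))"

lemma disc_iff: "z \<in> disc \<longleftrightarrow> cmod z < 1"
  by (simp add: disc_def)

lemma zero_in_disc [simp]: "0 \<in> disc"
  by (simp add: disc_iff)

lemma disc_norm_sq: "z \<in> disc \<Longrightarrow> 0 < 1 - (cmod z)\<^sup>2"
  by (simp add: disc_iff abs_square_less_1)

lemma mob_eq_act: "z \<in> disc \<Longrightarrow> mob a b z = act (a, b) z"
  by (simp add: mob_def act_def den_def)

lemma isom_iff: "isom g \<longleftrightarrow> (\<exists>p\<in>SU11. g = mob (fst p) (snd p))"
  by (auto simp: isom_def SU11_def)

lemma su_norm_nonneg: "0 \<le> su_norm p"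
  by (simp add: su_norm_def)

lemma su_norm_mult: "su_norm (p \<odot> q) \<le> su_norm p * su_norm q"
proof -
  have "su_norm (p \<odot> q) \<le> (cmod (fst p * fst q) + cmod (snd p * cnj (snd q)))
      + (cmod (fst p * snd q) + cmod (snd p * cnj (fst q)))"
    unfolding su_norm_def su_mult_def fst_conv snd_conv by (intro add_mono norm_triangle_ineq)
  also have "\<dots> = su_norm p * su_norm q"
    by (simp add: su_norm_def norm_mult algebra_simps)
  finally show ?thesis .
qed

lemma su_norm_inv [simp]: "su_norm (su_inv p) = su_norm p"
  by (simp add: su_norm_def su_inv_def)

lemma su_norm_boost: "su_norm (boost t) \<le> exp (\<bar>t\<bar>/2)"
proof -
  have "cosh (t/2) + \<bar>sinh (t/2)\<bar> = exp (\<bar>t\<bar>/2)"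
    by (cases "t \<ge> 0") (auto simp: cosh_plus_sinh cosh_minus_sinh)
  then show ?thesis by (simp add: su_norm_def boost_def)
qed

lemma su_one_in [simp]: "su_one \<in> SU11"
  by (simp add: su_one_def SU11_def)

lemma su_inv_in [simp]: "p \<in> SU11 \<Longrightarrow> su_inv p \<in> SU11"
  by (simp add: su_inv_def SU11_def)

lemma su_mult_in [simp]:
  assumes "p \<in> SU11" "q \<in> SU11" shows "p \<odot> q \<in> SU11"
proof -
  \<comment> \<open>Multiplicativity of the determinant.\<close>
  have *: "(cmod (a * c + b * cnj d))\<^sup>2 - (cmod (a * d + b * cnj c))\<^sup>2
     = ((cmod a)\<^sup>2 - (cmod b)\<^sup>2) * ((cmod c)\<^sup>2 - (cmod d)\<^sup>2)" for a b c d
    unfolding cmod_power2 by (simp add: algebra_simps power2_eq_square)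
  show ?thesis using assms * by (simp add: SU11_def su_mult_def)
qed

lemma boost_in [simp]: "boost t \<in> SU11"
  using cosh_square_eq[of "t/2"] by (simp add: boost_def SU11_def)

lemma su_mult_assoc: "(p \<odot> q) \<odot> r = p \<odot> (q \<odot> r)"
  by (simp add: su_mult_def algebra_simps)

lemma su_one_left [simp]: "su_one \<odot> p = p"
  and su_one_right [simp]: "p \<odot> su_one = p"
  by (simp_all add: su_mult_def su_one_def)

lemma su_det: "p \<in> SU11 \<Longrightarrow> fst p * cnj (fst p) - snd p * cnj (snd p) = 1"
  unfolding SU11_def mem_Collect_eq complex_norm_square[symmetric]
  by (metis of_real_1 of_real_diff)

lemma su_inv_left [simp]: "p \<in> SU11 \<Longrightarrow> su_inv p \<odot> p = su_one"
  and su_inv_right [simp]: "p \<in> SU11 \<Longrightarrow> p \<odot> su_inv p = su_one"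
  using su_det[of p] by (simp_all add: su_mult_def su_one_def su_inv_def algebra_simps)

lemma su_inv_left' [simp]: "p \<in> SU11 \<Longrightarrow> su_inv p \<odot> (p \<odot> q) = q"
  and su_inv_right' [simp]: "p \<in> SU11 \<Longrightarrow> p \<odot> (su_inv p \<odot> q) = q"
  by (simp_all add: su_mult_assoc[symmetric])

lemma su_inv_inv [simp]: "su_inv (su_inv p) = p"
  by (simp add: su_inv_def)

lemma su_inv_mult: "su_inv (p \<odot> q) = su_inv q \<odot> su_inv p"
  by (simp add: su_inv_def su_mult_def algebra_simps)

lemma su_mult_minus: "(- p) \<odot> q = - (p \<odot> q)"
  by (simp add: su_mult_def)

lemma su_minus_in [simp]: "- p \<in> SU11 \<longleftrightarrow> p \<in> SU11"
  by (simp add: SU11_def)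

lemma act_minus [simp]: "act (- p) z = act p z"
proof -
  have "act (- p) z = (- (fst p * z + snd p)) / (- den p z)" by (simp add: act_def den_def algebra_simps)
  then show ?thesis by (simp only: minus_divide_divide act_def)
qed

lemma boost_add: "boost s \<odot> boost t = boost (s + t)"
  by (simp add: boost_def su_mult_def cosh_add sinh_add add_divide_distrib algebra_simps)

lemma boost_0 [simp]: "boost 0 = su_one"
  by (simp add: boost_def su_one_def)

lemma su_less:
  assumes "p \<in> SU11" shows "cmod (snd p) < cmod (fst p)" "1 \<le> cmod (fst p)"
proof -
  have *: "(cmod (fst p))\<^sup>2 = 1 + (cmod (snd p))\<^sup>2" using assms by (simp add: SU11_def)
  show "cmod (snd p) < cmod (fst p)"
    by (rule power2_less_imp_less) (use * in auto)
  show "1 \<le> cmod (fst p)"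
    by (rule power2_le_imp_le) (use * in auto)
qed

text \<open>As |snd p| < |fst p|, the denominator is small only if z is close to the circle. The
  lower bound turns control of \<open>den\<close> into control of the matrix, as
  \<open>finite_orbit\<close> requires.\<close>

lemma den_bounds:
  assumes "p \<in> SU11" "z \<in> disc"
  shows "cmod (fst p) * (1 - cmod z) \<le> cmod (den p z)" "cmod (den p z) \<le> su_norm p"
proof -
  have z: "cmod z < 1" using assms by (simp add: disc_iff)
  have "cmod (snd p) * cmod z \<le> cmod (fst p) * cmod z"
    using su_less[OF assms(1)] by (intro mult_right_mono) auto
  moreover have "cmod (fst p) - cmod (snd p) * cmod z \<le> cmod (den p z)"
    using norm_diff_ineq[of "cnj (fst p)" "cnj (snd p) * z"] by (simp add: den_def norm_mult add.commute)
  ultimately show "cmod (fst p) * (1 - cmod z) \<le> cmod (den p z)" by (simp add: algebra_simps)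
  have "cmod (den p z) \<le> cmod (snd p) * cmod z + cmod (fst p)"
    using norm_triangle_ineq[of "cnj (snd p) * z" "cnj (fst p)"] by (simp add: den_def norm_mult)
  also have "\<dots> \<le> su_norm p"
    using z mult_left_mono[of "cmod z" 1 "cmod (snd p)"] by (simp add: su_norm_def)
  finally show "cmod (den p z) \<le> su_norm p" .
qed

lemma den_nonzero:
  assumes "p \<in> SU11" "z \<in> disc" shows "den p z \<noteq> 0"
proof -
  have "0 < cmod (fst p) * (1 - cmod z)"
    using assms(2) su_less(2)[OF assms(1)] by (intro mult_pos_pos) (auto simp: disc_iff)
  then show ?thesis using den_bounds[OF assms] by auto
qed

text \<open>Infinitesimal form of invariance of the metric, 1 / |den p z|^2 being the modulus of the
  derivative.\<close>

lemma one_minus_act: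
  assumes "p \<in> SU11" "z \<in> disc"
  shows "1 - (cmod (act p z))\<^sup>2 = (1 - (cmod z)\<^sup>2) / (cmod (den p z))\<^sup>2"
proof -
  have *: "(cmod (cnj b * z + cnj a))\<^sup>2 - (cmod (a * z + b))\<^sup>2
     = ((cmod a)\<^sup>2 - (cmod b)\<^sup>2) * (1 - (cmod z)\<^sup>2)" for a b
    unfolding cmod_power2 by (simp add: algebra_simps power2_eq_square)
  have "(cmod (den p z))\<^sup>2 - (cmod (fst p * z + snd p))\<^sup>2 = 1 - (cmod z)\<^sup>2"
    using *[of "snd p" "fst p"] assms by (simp add: SU11_def den_def)
  moreover have "(cmod (den p z))\<^sup>2 \<noteq> 0" using den_nonzero[OF assms] by simp
  ultimately show ?thesis
    by (simp add: act_def norm_divide power_divide field_simps)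
qed

lemma act_in_disc [simp]:
  assumes "p \<in> SU11" "z \<in> disc" shows "act p z \<in> disc"
proof -
  have "0 < 1 - (cmod (act p z))\<^sup>2"
    unfolding one_minus_act[OF assms] using disc_norm_sq[OF assms(2)] den_nonzero[OF assms] by simp
  then show ?thesis by (simp add: disc_iff abs_square_less_1)
qed

lemma act_mult:
  assumes "p \<in> SU11" "q \<in> SU11" "z \<in> disc"
  shows "act (p \<odot> q) z = act p (act q z)"
proof -
  have q: "den q z \<noteq> 0" using den_nonzero assms by blast
  have num: "(fst p * act q z + snd p) * den q z = fst (p \<odot> q) * z + snd (p \<odot> q)"
    using q by (simp add: act_def su_mult_def den_def field_simps)
  have dn: "den p (act q z) * den q z = den (p \<odot> q) z"
    using q by (simp add: act_def su_mult_def den_def field_simps)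
  have "act (p \<odot> q) z = ((fst p * act q z + snd p) * den q z) / (den p (act q z) * den q z)"
    unfolding num dn by (simp add: act_def)
  then show ?thesis using q by (simp add: act_def)
qed

lemma act_one [simp]: "act su_one z = z"
  by (simp add: act_def su_one_def den_def)

lemma act_inv_act [simp]: "p \<in> SU11 \<Longrightarrow> z \<in> disc \<Longrightarrow> act (su_inv p) (act p z) = z"
  and act_act_inv [simp]: "p \<in> SU11 \<Longrightarrow> z \<in> disc \<Longrightarrow> act p (act (su_inv p) z) = z"
  by (simp_all add: act_mult[symmetric])

lemma mob_comp:
  assumes "p \<in> SU11" "q \<in> SU11"
  shows "mob (fst p) (snd p) \<circ> mob (fst q) (snd q) = mob (fst (p \<odot> q)) (snd (p \<odot> q))"
proof
  fix z
  show "(mob (fst p) (snd p) \<circ> mob (fst q) (snd q)) z = mob (fst (p \<odot> q)) (snd (p \<odot> q)) z"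
  proof (cases "z \<in> disc")
    case True
    then show ?thesis using assms by (simp add: mob_eq_act act_mult del: fst_conv snd_conv)
  qed (simp add: mob_def)
qed

lemma act_diff:
  assumes "p \<in> SU11" "z \<in> disc" "w \<in> disc"
  shows "act p z - act p w = (z - w) / (den p z * den p w)"
proof -
  have d: "den p z \<noteq> 0" "den p w \<noteq> 0" using den_nonzero assms by auto
  have "act p z - act p w
      = ((fst p * z + snd p) * den p w - (fst p * w + snd p) * den p z) / (den p z * den p w)"
    using d by (simp add: act_def field_simps)
  also have "(fst p * z + snd p) * den p w - (fst p * w + snd p) * den p z
      = (fst p * cnj (fst p) - snd p * cnj (snd p)) * (z - w)"
    by (simp add: den_def algebra_simps)
  finally show ?thesis using su_det[OF assms(1)] by simp
qed

lemma hdist_act: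
  assumes "p \<in> SU11" "z \<in> disc" "w \<in> disc"
  shows "hdist (act p z) (act p w) = hdist z w"
proof -
  have d: "den p z \<noteq> 0" "den p w \<noteq> 0" using den_nonzero assms by auto
  then show ?thesis
    unfolding hdist_def act_diff[OF assms] one_minus_act[OF assms(1,2)] one_minus_act[OF assms(1,3)]
    by (simp add: norm_divide norm_mult power_divide power_mult_distrib)
qed

text \<open>An element fixing the whole disc is diagonal, by its value at 0, and its diagonal is
  real, by its value at one further point; determinant 1 leaves only the two signs.\<close>

lemma su_eq_or_minus:
  assumes "p \<in> SU11" "q \<in> SU11" "mob (fst p) (snd p) = mob (fst q) (snd q)"
  shows "p = q \<or> p = - q"
proof -
  define m where "m = su_inv q \<odot> p"
  have m: "m \<in> SU11" using assms by (simp add: m_def)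
  have id: "act m z = z" if "z \<in> disc" for z
  proof -
    have "act p z = act q z" using assms(3) that by (metis mob_eq_act prod.collapse)
    then show ?thesis using assms that by (simp add: m_def act_mult)
  qed
  have eq: "fst m * z + snd m = z * den m z" if "z \<in> disc" for z
    using id[OF that] den_nonzero[OF m that] by (simp add: act_def field_simps)
  have b: "snd m = 0" using eq[of 0] by simp
  have a: "fst m = cnj (fst m)" using eq[of "1/2"] b by (simp add: den_def disc_iff)
  then have "fst m * fst m = 1" using su_det[OF m] b by simp
  then have "fst m = 1 \<or> fst m = -1" by (simp add: square_eq_1_iff)
  then have "m = su_one \<or> m = - su_one" using b by (auto simp: su_one_def prod_eq_iff)
  moreover have "p = q \<odot> m" using assms by (simp add: m_def)
  moreover have "q \<odot> (- su_one) = - q" by (simp add: su_mult_def su_one_def prod_eq_iff)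
  ultimately show ?thesis by auto
qed

section \<open>Coordinates relative to a geodesic\<close>

text \<open>The Cayley map (1 + w) / (1 - w) takes the disc to the right half-plane and the real
  diameter to the positive axis. Geodesics orthogonal to the diameter become arcs of circles about
  0, so the logarithm of the modulus is the parameter of the projection.\<close>

definition foot :: "complex \<Rightarrow> real" where
  "foot w = ln (cmod (1 + w) / cmod (1 - w))"

text \<open>A hyperboloid coordinate, equal to sinh of the signed distance to the real
  diameter.\<close>

definition height :: "complex \<Rightarrow> real" where
  "height w = 2 * Im w / (1 - (cmod w)\<^sup>2)"

lemma one_minus_tanh_sq: "1 - (tanh x)\<^sup>2 = 1 / (cosh x)\<^sup>2" for x :: real
proof -
  have "1 - (tanh x)\<^sup>2 = ((cosh x)\<^sup>2 - (sinh x)\<^sup>2) / (cosh x)\<^sup>2"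
    by (simp add: tanh_def power_divide diff_divide_distrib)
  then show ?thesis by (simp add: cosh_square_eq)
qed

lemma std_geod_in_disc [simp]: "std_geod t \<in> disc"
proof -
  have "\<bar>tanh (t / 2)\<bar> < 1" using tanh_real_bounds[of "t/2"] by auto
  then show ?thesis by (simp add: std_geod_def disc_iff)
qed

lemma std_geod_0 [simp]: "std_geod 0 = 0"
  by (simp add: std_geod_def)

lemma std_geod_eqs:
  defines "r \<equiv> \<lambda>t. tanh (t/2) :: real"
  shows "(1 + (r t)\<^sup>2) / (1 - (r t)\<^sup>2) = cosh t" "2 * r t / (1 - (r t)\<^sup>2) = sinh t"
proof -
  have c: "cosh (t/2) \<noteq> 0" by simp
  have r: "r t = sinh (t/2) / cosh (t/2)" by (simp add: r_def tanh_def)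
  have d: "1 - (r t)\<^sup>2 = 1 / (cosh (t/2))\<^sup>2"
    unfolding r_def by (rule one_minus_tanh_sq)
  show "(1 + (r t)\<^sup>2) / (1 - (r t)\<^sup>2) = cosh t"
    unfolding d using cosh_double[of "t/2"] c by (simp add: r field_simps)
  show "2 * r t / (1 - (r t)\<^sup>2) = sinh t"
    unfolding d using sinh_double[of "t/2"] c by (simp add: r field_simps power2_eq_square)
qed

lemma act_boost_std_geod: "act (boost s) (std_geod t) = std_geod (s + t)"
proof -
  have c: "cosh (t/2) \<noteq> 0" by simp
  have "act (boost s) (std_geod t)
     = of_real ((cosh (s/2) * tanh (t/2) + sinh (s/2)) / (sinh (s/2) * tanh (t/2) + cosh (s/2)))"
    by (simp add: act_def den_def boost_def std_geod_def)
  also have "(cosh (s/2) * tanh (t/2) + sinh (s/2)) / (sinh (s/2) * tanh (t/2) + cosh (s/2))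
     = ((cosh (s/2) * tanh (t/2) + sinh (s/2)) * cosh (t/2)) / ((sinh (s/2) * tanh (t/2) + cosh (s/2)) * cosh (t/2))"
    using c by simp
  also have "\<dots> = sinh ((s + t)/2) / cosh ((s + t)/2)"
    using c by (simp add: tanh_def sinh_add cosh_add add_divide_distrib algebra_simps)
  finally show ?thesis by (simp add: std_geod_def tanh_def)
qed

lemma hdist_arg_ge_1:
  assumes "z \<in> disc" "w \<in> disc"
  shows "1 \<le> 1 + 2 * (cmod (z - w))\<^sup>2 / ((1 - (cmod z)\<^sup>2) * (1 - (cmod w)\<^sup>2))"
  using disc_norm_sq[OF assms(1)] disc_norm_sq[OF assms(2)] by simp

lemma cosh_hdist:
  assumes "z \<in> disc" "w \<in> disc"
  shows "cosh (hdist z w) = 1 + 2 * (cmod (z - w))\<^sup>2 / ((1 - (cmod z)\<^sup>2) * (1 - (cmod w)\<^sup>2))"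
  unfolding hdist_def using hdist_arg_ge_1[OF assms] by (rule cosh_arcosh_real)

lemma hdist_nonneg:
  assumes "z \<in> disc" "w \<in> disc" shows "0 \<le> hdist z w"
  unfolding hdist_def using hdist_arg_ge_1[OF assms] by (rule arcosh_nonneg_real)

lemma hdist_commute: "hdist z w = hdist w z"
  by (simp add: hdist_def norm_minus_commute mult.commute)

text \<open>Lorentz product of (1 + |w|^2, 2 Re w, 2 Im w) / (1 - |w|^2) with (cosh t, sinh t, 0) in
  the hyperboloid model.\<close>

lemma cosh_hdist_std:
  assumes "w \<in> disc"
  shows "cosh (hdist w (std_geod t)) = (cosh t * (1 + (cmod w)\<^sup>2) - 2 * sinh t * Re w) / (1 - (cmod w)\<^sup>2)"
proof -
  define r where "r = tanh (t/2)"
  have r: "1 - r\<^sup>2 > 0" using disc_norm_sq[OF std_geod_in_disc[of t]] by (simp add: std_geod_def r_def)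
  have w: "1 - (cmod w)\<^sup>2 > 0" by (rule disc_norm_sq[OF assms])
  have n: "(cmod (w - std_geod t))\<^sup>2 = (cmod w)\<^sup>2 - 2 * r * Re w + r\<^sup>2"
    unfolding cmod_power2 by (simp add: std_geod_def r_def power2_eq_square algebra_simps)
  have "cosh (hdist w (std_geod t)) = 1 + 2 * ((cmod w)\<^sup>2 - 2 * r * Re w + r\<^sup>2) / ((1 - (cmod w)\<^sup>2) * (1 - r\<^sup>2))"
    unfolding cosh_hdist[OF assms std_geod_in_disc] n by (simp add: std_geod_def r_def)
  also have "\<dots> = (((1 + r\<^sup>2) / (1 - r\<^sup>2)) * (1 + (cmod w)\<^sup>2) - 2 * (2 * r / (1 - r\<^sup>2)) * Re w) / (1 - (cmod w)\<^sup>2)"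
    using r w by (simp add: divide_simps) (simp add: algebra_simps)
  finally show ?thesis using std_geod_eqs[of t] by (simp add: r_def)
qed

lemma norm_one_plus_minus:
  assumes "w \<in> disc"
  shows "cmod (1 + w) > 0" "cmod (1 - w) > 0"
    "(cmod (1 + w))\<^sup>2 = 1 + (cmod w)\<^sup>2 + 2 * Re w" "(cmod (1 - w))\<^sup>2 = 1 + (cmod w)\<^sup>2 - 2 * Re w"
proof -
  have "1 + w \<noteq> 0" "1 - w \<noteq> 0"
    using assms by (auto simp: disc_iff add_eq_0_iff eq_neg_iff_add_eq_0[symmetric] norm_minus_cancel)
  then show "cmod (1 + w) > 0" "cmod (1 - w) > 0" by auto
qed (simp_all only: cmod_power2, simp_all add: power2_eq_square algebra_simps)

text \<open>Pythagoras in the right-angled triangle formed by w, its projection and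
  \<open>std_geod t\<close>; the root is cosh of the distance from w to the diameter. Existence and
  uniqueness of the nearest point can be read off from the factor in t.\<close>

lemma cosh_hdist_foot:
  assumes "w \<in> disc"
  shows "cosh (hdist w (std_geod t)) = sqrt (1 + (height w)\<^sup>2) * cosh (t - foot w)"
proof -
  define P Q where "P = cmod (1 + w)" and "Q = cmod (1 - w)"
  have PQ: "P > 0" "Q > 0" "P\<^sup>2 = 1 + (cmod w)\<^sup>2 + 2 * Re w" "Q\<^sup>2 = 1 + (cmod w)\<^sup>2 - 2 * Re w"
    using norm_one_plus_minus[OF assms] by (simp_all add: P_def Q_def)
  have w: "1 - (cmod w)\<^sup>2 > 0" by (rule disc_norm_sq[OF assms])
  have "(P * Q / (1 - (cmod w)\<^sup>2))\<^sup>2 = 1 + (height w)\<^sup>2"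
  proof -
    have "P\<^sup>2 * Q\<^sup>2 = (1 - (cmod w)\<^sup>2)\<^sup>2 + 4 * (Im w)\<^sup>2"
      unfolding PQ cmod_power2 by algebra
    then show ?thesis using w
      by (simp add: height_def power_divide power_mult_distrib divide_simps)
  qed
  then have K: "sqrt (1 + (height w)\<^sup>2) = P * Q / (1 - (cmod w)\<^sup>2)"
    using PQ(1,2) w by (intro real_sqrt_unique) auto
  have e: "exp (foot w) = P / Q" "exp (- foot w) = Q / P"
    using PQ(1,2) by (simp_all add: foot_def P_def Q_def exp_minus)
  have c: "cosh (foot w) = (P\<^sup>2 + Q\<^sup>2) / (2 * P * Q)"
    unfolding cosh_def e using PQ(1,2) by (simp add: field_simps power2_eq_square)
  have s: "sinh (foot w) = (P\<^sup>2 - Q\<^sup>2) / (2 * P * Q)"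
    unfolding sinh_def e using PQ(1,2) by (simp add: field_simps power2_eq_square)
  have "sqrt (1 + (height w)\<^sup>2) * cosh (t - foot w)
     = (cosh t * ((P\<^sup>2 + Q\<^sup>2)/2) - sinh t * ((P\<^sup>2 - Q\<^sup>2)/2)) / (1 - (cmod w)\<^sup>2)"
    unfolding K cosh_diff c s using PQ(1,2) w by (simp add: divide_simps)
  also have "\<dots> = cosh (hdist w (std_geod t))"
    unfolding cosh_hdist_std[OF assms] PQ by simp
  finally show ?thesis by simp
qed

lemma hdist_std_foot_le:
  assumes "w \<in> disc"
  shows "hdist w (std_geod (foot w)) \<le> hdist w (std_geod t)"
proof -
  have "sqrt (1 + (height w)\<^sup>2) * 1 \<le> sqrt (1 + (height w)\<^sup>2) * cosh (t - foot w)"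
    by (intro mult_left_mono cosh_real_ge_1) auto
  then have "cosh (hdist w (std_geod (foot w))) \<le> cosh (hdist w (std_geod t))"
    unfolding cosh_hdist_foot[OF assms] by simp
  then show ?thesis
    by (simp add: cosh_real_nonneg_le_iff hdist_nonneg assms)
qed

lemma dist_geod_std:
  assumes "w \<in> disc"
  shows "dist_geod w std_geod = hdist w (std_geod (foot w))"
  unfolding dist_geod_def
  by (rule cInf_eq_minimum) (auto simp: hdist_std_foot_le[OF assms])

lemma hdist_std_eq_iff:
  assumes "w \<in> disc"
  shows "hdist w (std_geod t) = dist_geod w std_geod \<longleftrightarrow> t = foot w"
proof
  assume "hdist w (std_geod t) = dist_geod w std_geod"
  then have "sqrt (1 + (height w)\<^sup>2) * cosh (t - foot w) = sqrt (1 + (height w)\<^sup>2) * 1"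
    using cosh_hdist_foot[OF assms, of t] cosh_hdist_foot[OF assms, of "foot w"]
    by (simp add: dist_geod_std[OF assms])
  moreover have "0 < 1 + (height w)\<^sup>2" by (intro add_pos_nonneg) auto
  ultimately have "cosh (t - foot w) = 1" by simp
  then show "t = foot w" by simp
qed (simp add: dist_geod_std[OF assms])

lemma sinh_dist_geod_std:
  assumes "w \<in> disc" shows "sinh (dist_geod w std_geod) = \<bar>height w\<bar>"
proof -
  have nn: "0 \<le> dist_geod w std_geod"
    using assms by (simp add: dist_geod_std hdist_nonneg)
  have "cosh (dist_geod w std_geod) = sqrt (1 + (height w)\<^sup>2)"
    using cosh_hdist_foot[OF assms, of "foot w"] by (simp add: dist_geod_std[OF assms])
  then have "(sinh (dist_geod w std_geod))\<^sup>2 = (height w)\<^sup>2"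
    using cosh_square_eq[of "dist_geod w std_geod"] by simp
  then show ?thesis using nn sinh_real_nonneg_iff[of "dist_geod w std_geod"]
    by (auto simp: power2_eq_iff simp del: sinh_real_nonneg_iff)
qed

lemma hdist_act_std:
  assumes "p \<in> SU11" "y \<in> disc"
  shows "hdist y (act p (std_geod s)) = hdist (act (su_inv p) y) (std_geod s)"
  using hdist_act[of p "act (su_inv p) y" "std_geod s"] assms by simp

lemma dist_geod_act:
  assumes "p \<in> SU11" "y \<in> disc"
  shows "dist_geod y (\<lambda>s. act p (std_geod s)) = dist_geod (act (su_inv p) y) std_geod"
  using assms by (simp add: dist_geod_def hdist_act_std)

text \<open>\<open>pos_side\<close> ranges over all isometries that parametrise the given geodesic.
  Two of them differ by an element fixing the diameter pointwise, so they agree and the positive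
  side is well defined.\<close>

lemma su_fix_std_geod:
  assumes "m \<in> SU11" "\<And>t. act m (std_geod t) = std_geod t" "z \<in> disc"
  shows "act m z = z"
proof -
  have eq: "fst m * w + snd m = w * den m w" if "w = std_geod t" for w t
    using assms(2)[of t] den_nonzero[OF assms(1), of w] that by (simp add: act_def field_simps)
  have b: "snd m = 0" using eq[of 0 0] by simp
  have "std_geod 1 \<noteq> 0" by (simp add: std_geod_def)
  then have a: "fst m = cnj (fst m)" using eq[OF refl, of 1] b by (simp add: den_def)
  have "fst m \<noteq> 0" using su_less(2)[OF assms(1)] by auto
  then show ?thesis using a b by (simp add: act_def den_def)
qed

lemma pos_side_act:
  assumes "p \<in> SU11"
  shows "pos_side (\<lambda>s. act p (std_geod s)) = {y \<in> disc. height (act (su_inv p) y) > 0}"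
proof -
  have pos: "height w > 0 \<longleftrightarrow> Im w > 0" if "w \<in> disc" for w
    using disc_norm_sq[OF that] by (simp add: height_def zero_less_divide_iff)
  have sub: "y \<in> disc \<and> Im (act (su_inv p) y) > 0"
    if "q \<in> SU11" and eq: "\<forall>t. act p (std_geod t) = act q (std_geod t)" and "w \<in> disc" "Im w > 0" "y = act q w"
    for y q w
  proof -
    have fx: "act (su_inv p \<odot> q) (std_geod t) = std_geod t" for t
      using assms that(1) by (simp add: act_mult eq[rule_format, symmetric])
    have "act (su_inv p \<odot> q) w = w"
      by (rule su_fix_std_geod[OF su_mult_in[OF su_inv_in[OF assms] that(1)] fx that(3)])
    then have "act (su_inv p) y = w" using assms that(1,3,5) by (simp add: act_mult)
    then show ?thesis using that(1,3,4,5) by simp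
  qed
  show ?thesis
  proof (intro set_eqI iffI)
    fix y assume "y \<in> pos_side (\<lambda>s. act p (std_geod s))"
    then obtain M w where M: "isom M" "\<forall>t. act p (std_geod t) = M (std_geod t)" "w \<in> disc" "Im w > 0" "y = M w"
      by (auto simp: pos_side_def)
    from M(1) obtain q where q: "q \<in> SU11" "M = mob (fst q) (snd q)" by (auto simp: isom_iff)
    have "y \<in> disc \<and> Im (act (su_inv p) y) > 0"
      by (rule sub[OF q(1) _ M(3,4)]) (use M q in \<open>simp_all add: mob_eq_act\<close>)
    then show "y \<in> {y \<in> disc. height (act (su_inv p) y) > 0}" using pos assms by simp
  next
    fix y assume "y \<in> {y \<in> disc. height (act (su_inv p) y) > 0}"
    then have y: "y \<in> disc" "Im (act (su_inv p) y) > 0" using pos assms by auto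
    show "y \<in> pos_side (\<lambda>s. act p (std_geod s))"
      unfolding pos_side_def mem_Collect_eq
      by (rule exI[of _ "mob (fst p) (snd p)"], rule exI[of _ "act (su_inv p) y"])
        (use y assms in \<open>auto simp: isom_iff mob_eq_act\<close>)
  qed
qed

section \<open>Every unit-speed geodesic comes from a frame\<close>

lemma unit_geodesic_act:
  assumes "unit_geodesic k" "p \<in> SU11"
  shows "unit_geodesic (\<lambda>t. act p (k t))"
  using assms by (simp add: unit_geodesic_def hdist_act)

text \<open>\<open>unit_geodesic\<close> only asks that distances be preserved, so each point is
  located by its distances to k 0 and k 1: the first gives the modulus, the second the real part,
  and these coincide up to sign, which leaves no imaginary part.\<close>

lemma unit_geodesic_std_aux:
  assumes k: "unit_geodesic k" and k0: "k 0 = 0" and k1: "k 1 = of_real r" "r \<ge> 0"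
  shows "k t = std_geod t"
proof -
  have kd: "k t \<in> disc" for t using k by (simp add: unit_geodesic_def)
  have kh: "hdist (k s) (k t) = \<bar>s - t\<bar>" for s t using k by (simp add: unit_geodesic_def)
  have inj: "a = b" if "(1 + a) / (1 - a) = (1 + b) / (1 - b)" "a < 1" "b < 1" for a b :: real
    using that by (simp add: field_simps)
  define T where "T = (\<lambda>t::real. tanh (t/2))"
  have T: "std_geod t = of_real (T t)" "(1 + (T t)\<^sup>2) / (1 - (T t)\<^sup>2) = cosh t" "2 * T t / (1 - (T t)\<^sup>2) = sinh t"
    "(T t)\<^sup>2 < 1" for t
    using std_geod_eqs[of t] disc_norm_sq[OF std_geod_in_disc[of t]] by (simp_all add: T_def std_geod_def)
  have norm: "(cmod (k t))\<^sup>2 = (T t)\<^sup>2" for t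
  proof (rule inj)
    have "cosh (hdist (k t) (std_geod 0)) = cosh t" using kh[of t 0] k0 by simp
    then show "(1 + (cmod (k t))\<^sup>2) / (1 - (cmod (k t))\<^sup>2) = (1 + (T t)\<^sup>2) / (1 - (T t)\<^sup>2)"
      unfolding cosh_hdist_std[OF kd] T(2) by simp
  qed (use T disc_norm_sq[OF kd[of t]] in auto)
  have "r\<^sup>2 = (T 1)\<^sup>2" using norm[of 1] k1 by simp
  moreover have "T 1 \<ge> 0" by (simp add: T_def)
  ultimately have k1': "k 1 = std_geod 1" using k1 T(1) power2_eq_iff_nonneg by metis
  have "cosh (hdist (k t) (std_geod 1)) = cosh (1 - t)"
    using kh[of t 1] unfolding k1' by (simp add: abs_minus_commute)
  then have "cosh 1 * ((1 + (cmod (k t))\<^sup>2) / (1 - (cmod (k t))\<^sup>2)) - sinh 1 * (2 * Re (k t) / (1 - (cmod (k t))\<^sup>2))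
     = cosh 1 * cosh t - sinh 1 * sinh t"
    unfolding cosh_hdist_std[OF kd] cosh_diff by (simp add: diff_divide_distrib mult_ac)
  then have "sinh 1 * (2 * Re (k t) / (1 - (T t)\<^sup>2)) = sinh 1 * sinh t"
    unfolding norm T by simp
  then have "2 * Re (k t) / (1 - (T t)\<^sup>2) = 2 * T t / (1 - (T t)\<^sup>2)"
    using T(3) sinh_real_pos_iff[of 1] by (metis mult_cancel_left less_irrefl zero_less_one)
  then have "Re (k t) = T t" using T(4)[of t] by simp
  moreover from this have "Im (k t) = 0" using norm[of t] by (simp add: cmod_power2)
  ultimately show ?thesis by (simp add: T(1) complex_eq_iff)
qed

lemma su_transitive:
  assumes "z \<in> disc" obtains p where "p \<in> SU11" "act p 0 = z"
proof
  define c where "c = 1 / sqrt (1 - (cmod z)\<^sup>2)"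
  have d: "1 - (cmod z)\<^sup>2 > 0" by (rule disc_norm_sq[OF assms])
  then have c: "c\<^sup>2 * (1 - (cmod z)\<^sup>2) = 1" "c > 0" by (simp_all add: c_def power_divide)
  show "(of_real c, of_real c * z) \<in> SU11"
    using c by (simp add: SU11_def norm_mult power_mult_distrib algebra_simps)
  show "act (of_real c, of_real c * z) 0 = z" using c by (simp add: act_def den_def)
qed

lemma rot_in_SU11: "cmod u = 1 \<Longrightarrow> (u, 0) \<in> SU11"
  by (simp add: SU11_def)

lemma act_rot: "cmod u = 1 \<Longrightarrow> act (u, 0) z = u\<^sup>2 * z"
  using divide_conv_cnj[of "cnj u" "u * z"] by (simp add: act_def den_def power2_eq_square)

lemma unit_geodesic_imp:
  assumes k: "unit_geodesic k"
  obtains p where "p \<in> SU11" "k = (\<lambda>t. act p (std_geod t))"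
proof -
  have kd: "k t \<in> disc" for t using k by (simp add: unit_geodesic_def)
  obtain q where q: "q \<in> SU11" "act q 0 = k 0" using su_transitive[OF kd] .
  define w where "w = act (su_inv q) (k 1)"
  \<comment> \<open>Since (u, 0) multiplies by u^2, a square root of the direction of w is taken.
    The value 1 keeps both properties of u valid for w = 0.\<close>
  define u where "u = (if w = 0 then 1 else csqrt (w / of_real (cmod w)))"
  have u: "cmod u = 1" "u\<^sup>2 * of_real (cmod w) = w"
    by (auto simp: u_def norm_divide)
  define p where "p = q \<odot> (u, 0)"
  have p: "p \<in> SU11" using q u by (simp add: p_def rot_in_SU11)
  have inv_p: "act (su_inv p) z = act (su_inv (u, 0)) (act (su_inv q) z)" if "z \<in> disc" for z
    using that q u by (simp add: p_def su_inv_mult act_mult rot_in_SU11)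
  have 0: "act (su_inv p) (k 0) = 0"
    using kd q u act_inv_act[OF q(1), of 0] by (simp add: inv_p) (simp add: act_def su_inv_def)
  have "act (su_inv p) (k 1) = act (su_inv (u, 0)) (act (u, 0) (of_real (cmod w)))"
    using u kd by (simp add: inv_p act_rot flip: w_def)
  also have "\<dots> = of_real (cmod w)"
    using u q kd act_in_disc[of "su_inv q" "k 1"] by (intro act_inv_act rot_in_SU11) (auto simp: w_def disc_iff)
  finally have 1: "act (su_inv p) (k 1) = of_real (cmod w)" .
  have "act (su_inv p) (k t) = std_geod t" for t
    using unit_geodesic_std_aux[OF unit_geodesic_act[OF k] 0 1] p by simp
  then have "k t = act p (std_geod t)" for t
    using act_act_inv[OF p kd[of t]] by simp
  then show ?thesis using p that by blast
qed

text \<open>\<open>nbhd_plus\<close> in coordinates: of the two boundary curves only the one on the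
  positive side belongs to it.\<close>

definition strip :: "real \<Rightarrow> complex set" where
  "strip \<rho> = {w. - sinh \<rho> < height w \<and> height w \<le> sinh \<rho>}"

definition feet :: "complex set \<Rightarrow> real \<Rightarrow> complex \<times> complex \<Rightarrow> real set" where
  "feet Y \<rho> p = {foot (act (su_inv p) y) |y. y \<in> Y \<and> act (su_inv p) y \<in> strip \<rho>}"

lemma nbhd_plus_act:
  assumes "p \<in> SU11" "\<rho> > 0" "y \<in> disc"
  shows "y \<in> nbhd_plus (\<lambda>s. act p (std_geod s)) \<rho> \<longleftrightarrow> act (su_inv p) y \<in> strip \<rho>"
proof -
  define w where "w = act (su_inv p) y"
  have w: "w \<in> disc" using assms by (simp add: w_def)
  define d where "d = dist_geod w std_geod"
  have s: "sinh d = \<bar>height w\<bar>" using sinh_dist_geod_std[OF w] by (simp add: d_def)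
  have "d < \<rho> \<longleftrightarrow> \<bar>height w\<bar> < sinh \<rho>" unfolding s[symmetric] by simp
  moreover have "d = \<rho> \<longleftrightarrow> \<bar>height w\<bar> = sinh \<rho>" unfolding s[symmetric] by simp
  moreover have "sinh \<rho> > 0" using assms by simp
  ultimately have "d < \<rho> \<or> (d = \<rho> \<and> height w > 0) \<longleftrightarrow> - sinh \<rho> < height w \<and> height w \<le> sinh \<rho>"
    by linarith
  then show ?thesis
    using assms by (simp add: nbhd_plus_def pos_side_act dist_geod_act strip_def flip: w_def d_def)
qed

lemma S_plus_eq_feet:
  assumes "p \<in> SU11" "\<rho> > 0" "orbit \<Gamma> x \<subseteq> disc"
  shows "S_plus \<Gamma> (\<lambda>s. act p (std_geod s)) \<rho> x = feet (orbit \<Gamma> x) \<rho> p"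
proof -
  have "hdist y (act p (std_geod t)) = dist_geod y (\<lambda>s. act p (std_geod s)) \<longleftrightarrow> t = foot (act (su_inv p) y)"
    if "y \<in> disc" for y t
    using assms that by (simp add: hdist_act_std dist_geod_act hdist_std_eq_iff)
  then show ?thesis
    unfolding S_plus_def feet_def using assms(3) nbhd_plus_act[OF assms(1,2)]
    by (safe; blast)
qed

section \<open>Discreteness\<close>

lemma mob_minus [simp]: "mob (- a) (- b) = mob a b"
proof
  fix z show "mob (- a) (- b) z = mob a b z"
    using act_minus[of "(a, b)" z] by (cases "z \<in> disc") (simp_all add: mob_eq_act, simp add: mob_def)
qed

lemma mob_su_one: "mob (fst su_one) (snd su_one) = id"
  by (auto simp: mob_def su_one_def)

lemma su_norm_ge_1: "p \<in> SU11 \<Longrightarrow> 1 \<le> su_norm p"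
  using su_less(2)[of p] norm_ge_zero[of "snd p"] unfolding su_norm_def by linarith

lemma su_norm_le_norm: "su_norm p \<le> 2 * norm p"
  using norm_fst_le[of "fst p" "snd p"] norm_snd_le[of "snd p" "fst p"] by (simp add: su_norm_def)

lemma norm_le_su_norm: "norm p \<le> su_norm p"
  using norm_Pair_le[of "fst p" "snd p"] by (simp add: su_norm_def)

lemma su_mult_diff_right: "p \<odot> (q - r) = p \<odot> q - p \<odot> r"
  by (simp add: su_mult_def algebra_simps)

locale fuchsian_group =
  fixes \<Gamma> :: "(complex \<Rightarrow> complex) set"
  assumes fuchsian: "fuchsian \<Gamma>"
begin

text \<open>The preimage of \<Gamma> in the double cover. It contains q together with -q, so that
  sign choices can be absorbed into the group element.\<close>

definition lifts :: "(complex \<times> complex) set" where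
  "lifts = {p \<in> SU11. mob (fst p) (snd p) \<in> \<Gamma>}"

lemma lifts_SU11: "q \<in> lifts \<Longrightarrow> q \<in> SU11"
  by (simp add: lifts_def)

lemma lifts_surj:
  assumes "g \<in> \<Gamma>" obtains q where "q \<in> lifts" "g = mob (fst q) (snd q)"
  using assms fuchsian by (auto simp: fuchsian_def isom_iff lifts_def)

lemma lifts_minus: "q \<in> lifts \<Longrightarrow> - q \<in> lifts"
  by (simp add: lifts_def)

lemma lifts_mult: "q \<in> lifts \<Longrightarrow> r \<in> lifts \<Longrightarrow> q \<odot> r \<in> lifts"
  using fuchsian by (simp add: lifts_def fuchsian_def flip: mob_comp)

lemma lifts_inv:
  assumes q: "q \<in> lifts" shows "su_inv q \<in> lifts"
proof -
  from q have "mob (fst q) (snd q) \<in> \<Gamma>" by (simp add: lifts_def)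
  then obtain h where h: "h \<in> \<Gamma>" "mob (fst q) (snd q) \<circ> h = id"
    using fuchsian by (auto simp: fuchsian_def)
  obtain r where r: "r \<in> lifts" "h = mob (fst r) (snd r)" using lifts_surj[OF h(1)] .
  have "mob (fst (q \<odot> r)) (snd (q \<odot> r)) = mob (fst su_one) (snd su_one)"
    unfolding mob_su_one using h r q by (simp add: lifts_SU11 flip: mob_comp)
  then have "q \<odot> r = su_one \<or> q \<odot> r = - su_one"
    using q r by (intro su_eq_or_minus) (auto simp: lifts_SU11)
  moreover have "r = su_inv q \<odot> (q \<odot> r)" using q by (simp add: lifts_SU11)
  moreover have "su_inv q \<odot> (- su_one) = - su_inv q" by (simp add: su_mult_def su_one_def prod_eq_iff)
  ultimately have "r = su_inv q \<or> r = - su_inv q" by auto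
  then show ?thesis using r(1) lifts_minus[OF r(1)] by auto
qed

lemma orbit_eq:
  assumes x: "x \<in> disc" shows "orbit \<Gamma> x = (\<lambda>q. act q x) ` lifts"
proof (intro set_eqI iffI)
  fix y assume "y \<in> orbit \<Gamma> x"
  then obtain g where "g \<in> \<Gamma>" "y = g x" by (auto simp: orbit_def)
  then show "y \<in> (\<lambda>q. act q x) ` lifts" using x by (metis lifts_surj mob_eq_act prod.collapse imageI)
next
  fix y assume "y \<in> (\<lambda>q. act q x) ` lifts"
  then obtain q where "q \<in> lifts" "y = mob (fst q) (snd q) x" using x by (auto simp: mob_eq_act)
  then show "y \<in> orbit \<Gamma> x" by (auto simp: orbit_def lifts_def)
qed

lemma orbit_subset_disc: "x \<in> disc \<Longrightarrow> orbit \<Gamma> x \<subseteq> disc"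
  by (auto simp: orbit_eq lifts_SU11)

text \<open>For distinct q and r the quotient of the two stays away from 1, and
  \<open>su_inv q \<odot> r - su_one = su_inv q \<odot> (r - q)\<close> has norm at most R times
  that of r - q. Hence the bounded set is uniformly discrete.\<close>

lemma finite_lifts: "finite {q \<in> lifts. su_norm q \<le> R}"
proof (cases "R > 0")
  case False
  then have "{q \<in> lifts. su_norm q \<le> R} = {}"
    using su_norm_ge_1 lifts_SU11 by force
  then show ?thesis by (metis finite.emptyI)
next
  case R: True
  obtain e where e: "e > 0"
    "\<And>a b. (cmod a)\<^sup>2 - (cmod b)\<^sup>2 = 1 \<Longrightarrow> mob a b \<in> \<Gamma> \<Longrightarrow> mob a b \<noteq> id \<Longrightarrow>
              min (cmod (a - 1)) (cmod (a + 1)) + cmod b \<ge> e"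
    using fuchsian unfolding fuchsian_def by blast
  \<comment> \<open>The 2 covers -1, which acts as the identity and so escapes the discreteness
    bound e.\<close>
  have sep1: "min e 2 \<le> su_norm (m - su_one)" if m: "m \<in> lifts" "m \<noteq> su_one" for m
  proof (cases "mob (fst m) (snd m) = id")
    case True
    then have "m = - su_one"
      using su_eq_or_minus[of m su_one] m by (auto simp: mob_su_one lifts_SU11)
    then show ?thesis by (simp add: su_norm_def su_one_def)
  next
    case False
    then have "min (cmod (fst m - 1)) (cmod (fst m + 1)) + cmod (snd m) \<ge> e"
      using m by (intro e(2)) (auto simp: lifts_def SU11_def)
    then show ?thesis by (simp add: su_norm_def su_one_def)
  qed
  have "min e 2 / (2 * R) \<le> dist q r"
    if qr: "q \<in> {q \<in> lifts. su_norm q \<le> R}" "r \<in> {q \<in> lifts. su_norm q \<le> R}" "q \<noteq> r" for q r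
  proof -
    have "su_inv q \<odot> r \<noteq> su_one"
    proof
      assume "su_inv q \<odot> r = su_one"
      then have "q \<odot> (su_inv q \<odot> r) = q" by simp
      then show False using qr by (simp add: lifts_SU11)
    qed
    then have "min e 2 \<le> su_norm (su_inv q \<odot> r - su_one)"
      using qr by (intro sep1 lifts_mult lifts_inv) auto
    also have "su_inv q \<odot> r - su_one = su_inv q \<odot> (r - q)"
      using qr by (simp add: su_mult_diff_right lifts_SU11)
    also have "su_norm \<dots> \<le> R * su_norm (r - q)"
      using su_norm_mult[of "su_inv q" "r - q"] qr su_norm_nonneg[of "r - q"]
      by (simp add: order_trans[OF _ mult_right_mono])
    also have "\<dots> \<le> R * (2 * norm (r - q))"
      using R su_norm_le_norm by (intro mult_left_mono) auto
    finally show ?thesis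
      using R by (simp add: dist_norm norm_minus_commute field_simps)
  qed
  moreover have "min e 2 / (2 * R) > 0" using e R by simp
  moreover have "bounded {q \<in> lifts. su_norm q \<le> R}"
    unfolding bounded_iff using norm_le_su_norm order_trans by blast
  ultimately show ?thesis
    unfolding uniform_discrete_finite_iff[symmetric] uniform_discrete_def by (meson not_le)
qed

lemma finite_orbit:
  assumes x: "x \<in> disc" and c: "c > 0"
  shows "finite {y \<in> orbit \<Gamma> x. c \<le> 1 - (cmod y)\<^sup>2}"
proof -
  \<comment> \<open>The quotient bounds |fst q| by way of \<open>one_minus_act\<close> and
    \<open>den_bounds\<close>; the factor 2 accounts for |snd q| < |fst q|.\<close>
  define R where "R = 2 * (sqrt ((1 - (cmod x)\<^sup>2) / c) / (1 - cmod x))"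
  have x1: "cmod x < 1" using x by (simp add: disc_iff)
  have "{y \<in> orbit \<Gamma> x. c \<le> 1 - (cmod y)\<^sup>2} \<subseteq> (\<lambda>q. act q x) ` {q \<in> lifts. su_norm q \<le> R}"
  proof
    fix y assume "y \<in> {y \<in> orbit \<Gamma> x. c \<le> 1 - (cmod y)\<^sup>2}"
    then obtain q where q: "q \<in> lifts" "y = act q x" "c \<le> 1 - (cmod y)\<^sup>2"
      by (auto simp: orbit_eq[OF x])
    have q': "q \<in> SU11" using q by (simp add: lifts_SU11)
    have d: "0 < (cmod (den q x))\<^sup>2" using den_nonzero[OF q' x] by simp
    have "c \<le> (1 - (cmod x)\<^sup>2) / (cmod (den q x))\<^sup>2"
      using q by (simp add: one_minus_act[OF q' x])
    then have "(cmod (den q x))\<^sup>2 \<le> (1 - (cmod x)\<^sup>2) / c"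
      using d c by (simp add: field_simps)
    then have "cmod (den q x) \<le> sqrt ((1 - (cmod x)\<^sup>2) / c)"
      by (rule real_le_rsqrt)
    then have "cmod (fst q) * (1 - cmod x) \<le> sqrt ((1 - (cmod x)\<^sup>2) / c)"
      using den_bounds(1)[OF q' x] by linarith
    then have "cmod (fst q) \<le> sqrt ((1 - (cmod x)\<^sup>2) / c) / (1 - cmod x)"
      using x1 by (simp add: field_simps)
    then have "su_norm q \<le> R" using su_less(1)[OF q'] by (simp add: su_norm_def R_def)
    then show "y \<in> (\<lambda>q. act q x) ` {q \<in> lifts. su_norm q \<le> R}" using q by auto
  qed
  then show ?thesis using finite_lifts finite_subset by blast
qed

end

section \<open>Perturbing the geodesic\<close>

lemma tendsto_act_inv:
  assumes "(f \<longlongrightarrow> p) F" "p \<in> SU11" "y \<in> disc"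
  shows "((\<lambda>x. act (su_inv (f x)) y) \<longlongrightarrow> act (su_inv p) y) F"
  unfolding act_def den_def su_inv_def fst_conv snd_conv
  by (intro tendsto_intros tendsto_fst tendsto_snd assms(1))
    (use den_nonzero[OF su_inv_in[OF assms(2)] assms(3)] in \<open>simp add: den_def su_inv_def\<close>)

lemma tendsto_foot:
  assumes "(f \<longlongrightarrow> w) F" "w \<in> disc"
  shows "((\<lambda>x. foot (f x)) \<longlongrightarrow> foot w) F"
  unfolding foot_def
  by (intro tendsto_intros assms(1)) (use norm_one_plus_minus[OF assms(2)] in auto)

lemma tendsto_height:
  assumes "(f \<longlongrightarrow> w) F" "w \<in> disc"
  shows "((\<lambda>x. height (f x)) \<longlongrightarrow> height w) F"
  unfolding height_def
  by (intro tendsto_intros assms(1)) (use disc_norm_sq[OF assms(2)] in auto)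

lemma Im_divide_eq_cnj: "Im (z / w) = Im (z * cnj w) / (cmod w)\<^sup>2"
  by (simp add: complex_div_cnj[of z w] flip: of_real_power)

text \<open>Translation along the geodesic orthogonal to the standard one, towards its positive side.\<close>
definition push :: "real \<Rightarrow> complex \<times> complex" where
  "push t = (of_real (cosh (t/2)), \<i> * of_real (sinh (t/2)))"

lemma push_in [simp]: "push t \<in> SU11"
  using cosh_square_eq[of "t/2"] by (simp add: push_def SU11_def norm_mult)

text \<open>In the hyperboloid model a push is a Lorentz boost mixing the height with the time
  coordinate (1 + |w|^2) / (1 - |w|^2).\<close>

lemma height_push:
  assumes "w \<in> disc"
  shows "height (act (su_inv (push t)) w)
    = height w * cosh t - (1 + (cmod w)\<^sup>2) / (1 - (cmod w)\<^sup>2) * sinh t"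
proof -
  define c s where "c = cosh (t/2)" and "s = sinh (t/2)"
  define N D where "N = of_real c * w - \<i> * of_real s" and "D = \<i> * of_real s * w + of_real c"
  have D: "den (su_inv (push t)) w = D"
    by (simp add: den_def su_inv_def push_def D_def c_def s_def)
  have act: "act (su_inv (push t)) w = N / D"
    unfolding act_def D by (simp add: su_inv_def push_def N_def c_def s_def)
  have D0: "D \<noteq> 0" using den_nonzero[of "su_inv (push t)" w] assms D by simp
  have w: "1 - (cmod w)\<^sup>2 > 0" by (rule disc_norm_sq[OF assms])
  have "Im (N * cnj D) = (c\<^sup>2 + s\<^sup>2) * Im w - c * s * (1 + (cmod w)\<^sup>2)"
    unfolding N_def D_def cmod_power2 by (simp add: power2_eq_square algebra_simps)
  then have im: "Im (N * cnj D) = cosh t * Im w - sinh t / 2 * (1 + (cmod w)\<^sup>2)"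
    using cosh_double[of "t/2"] sinh_double[of "t/2"] by (simp add: c_def s_def)
  have "Im (N / D) = Im (N * cnj D) / (cmod D)\<^sup>2"
    by (rule Im_divide_eq_cnj)
  then have "height (N / D) = 2 * (Im (N * cnj D) / (cmod D)\<^sup>2) / ((1 - (cmod w)\<^sup>2) / (cmod D)\<^sup>2)"
    using one_minus_act[of "su_inv (push t)" w] assms unfolding act D height_def by simp
  also have "\<dots> = 2 * Im (N * cnj D) / (1 - (cmod w)\<^sup>2)" using D0 w by simp
  also have "\<dots> = height w * cosh t - (1 + (cmod w)\<^sup>2) / (1 - (cmod w)\<^sup>2) * sinh t"
    unfolding im height_def using w by (simp add: divide_simps) (simp add: algebra_simps)
  finally show ?thesis unfolding act .
qed

text \<open>The time coordinate exceeds |height|, so the height drops strictly at every point, on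
  whichever side of the geodesic it lies.\<close>

lemma height_push_less:
  assumes "w \<in> disc" "t > 0"
  shows "height (act (su_inv (push t)) w) < height w"
proof -
  define C A where "C = height w" and "A = (1 + (cmod w)\<^sup>2) / (1 - (cmod w)\<^sup>2)"
  have w: "1 - (cmod w)\<^sup>2 > 0" by (rule disc_norm_sq[OF assms(1)])
  have "2 * cmod w < 1 + (cmod w)\<^sup>2"
    using assms(1) zero_less_power2[of "1 - cmod w"] by (simp add: disc_iff power2_diff)
  then have "2 * \<bar>Im w\<bar> < 1 + (cmod w)\<^sup>2" using abs_Im_le_cmod[of w] by linarith
  then have "2 * \<bar>Im w\<bar> / (1 - (cmod w)\<^sup>2) < A" using w by (simp add: A_def divide_strict_right_mono)
  then have CA: "\<bar>C\<bar> < A" using w by (simp add: C_def height_def abs_mult)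
  have s: "sinh t > 0" using assms by simp
  have "C * cosh t - A * sinh t < C"
  proof (cases "C \<ge> 0")
    case True
    have "cosh t - sinh t < 1" using assms(2) by (simp add: cosh_minus_sinh)
    then have "C * (cosh t - sinh t) \<le> C * 1" using True by (intro mult_left_mono) auto
    moreover have "C * sinh t < A * sinh t" using CA s by simp
    ultimately show ?thesis by (simp add: algebra_simps)
  next
    case False
    then have "C * cosh t \<le> C * 1" using cosh_real_ge_1[of t] by (intro mult_left_mono_neg) auto
    moreover have "A * sinh t > 0" using CA s by simp
    ultimately show ?thesis by simp
  qed
  then show ?thesis using height_push[OF assms(1), of t] by (simp add: C_def A_def)
qed

lemma eventually_imp_const: "(A \<Longrightarrow> eventually P F) \<Longrightarrow> \<forall>\<^sub>F x in F. A \<longrightarrow> P x"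
  by (cases A) auto

text \<open>The bound depends on p only through R, so one finite set of orbit points serves all
  frames of norm at most R. It combines cosh of the distance from w to 0, at most cosh \<rho> * cosh
  r, with the fact that \<open>act p\<close> shrinks 1 - |w|^2 at most by the factor R^2.\<close>

lemma strip_preimage_bound:
  assumes p: "p \<in> SU11" and y: "y \<in> disc" and \<rho>: "\<rho> > 0"
    and w: "act (su_inv p) y \<in> strip \<rho>" "\<bar>foot (act (su_inv p) y)\<bar> \<le> r"
    and R: "su_norm p \<le> R"
  shows "1 / (cosh \<rho> * cosh r * R\<^sup>2) \<le> 1 - (cmod y)\<^sup>2"
proof -
  define w where "w = act (su_inv p) y"
  have wd: "w \<in> disc" using p y by (simp add: w_def)
  have d: "0 < 1 - (cmod w)\<^sup>2" by (rule disc_norm_sq[OF wd])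
  have "\<bar>height w\<bar> \<le> sinh \<rho>" using w by (auto simp: strip_def w_def)
  then have "(height w)\<^sup>2 \<le> (sinh \<rho>)\<^sup>2" by (simp add: abs_le_square_iff[symmetric] abs_of_nonneg)
  then have K: "sqrt (1 + (height w)\<^sup>2) \<le> cosh \<rho>"
    using cosh_square_eq[of \<rho>] by (intro real_le_lsqrt) auto
  have r: "r \<ge> 0" using w(2) by linarith
  have "cosh (foot w) \<le> cosh r"
    using w(2) r cosh_real_nonneg_le_iff[of "\<bar>foot w\<bar>" r] by (simp add: w_def)
  then have "sqrt (1 + (height w)\<^sup>2) * cosh (foot w) \<le> cosh \<rho> * cosh r"
    using K by (intro mult_mono) auto
  moreover have "(1 + (cmod w)\<^sup>2) / (1 - (cmod w)\<^sup>2) = sqrt (1 + (height w)\<^sup>2) * cosh (foot w)"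
    using cosh_hdist_std[OF wd, of 0] cosh_hdist_foot[OF wd, of 0] by simp
  moreover have "1 / (1 - (cmod w)\<^sup>2) \<le> (1 + (cmod w)\<^sup>2) / (1 - (cmod w)\<^sup>2)"
    using d by (intro divide_right_mono) auto
  ultimately have "1 / (1 - (cmod w)\<^sup>2) \<le> cosh \<rho> * cosh r" by linarith
  then have *: "1 / (cosh \<rho> * cosh r) \<le> 1 - (cmod w)\<^sup>2"
    using d by (simp add: field_simps)
  have "0 < su_norm p" using su_norm_ge_1[OF p] by simp
  have "cmod (den p w) \<le> R" using den_bounds(2)[OF p wd] R by linarith
  then have D: "(cmod (den p w))\<^sup>2 \<le> R\<^sup>2" by (simp add: power_mono)
  have "1 / (cosh \<rho> * cosh r * R\<^sup>2) = (1 / (cosh \<rho> * cosh r)) / R\<^sup>2" by simp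
  also have "\<dots> \<le> (1 - (cmod w)\<^sup>2) / (cmod (den p w))\<^sup>2"
    using * D d den_nonzero[OF p wd] by (intro frac_le) auto
  also have "\<dots> = 1 - (cmod y)\<^sup>2"
    using one_minus_act[OF p wd] p y by (simp add: w_def)
  finally show ?thesis .
qed

locale discrete_orbit =
  fixes Y :: "complex set" and \<rho> :: real
  assumes Y_disc: "Y \<subseteq> disc"
    and Y_finite: "c > 0 \<Longrightarrow> finite {y \<in> Y. c \<le> 1 - (cmod y)\<^sup>2}"
    and \<rho>_pos: "\<rho> > 0"
begin

text \<open>By \<open>in_near\<close> these are the only points able to produce a foot in [-r, r]
  for a frame of norm at most R.\<close>

definition near :: "real \<Rightarrow> real \<Rightarrow> complex set" where
  "near r R = {y \<in> Y. 1 / (cosh \<rho> * cosh r * R\<^sup>2) \<le> 1 - (cmod y)\<^sup>2}"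

lemma finite_near: "R > 0 \<Longrightarrow> finite (near r R)"
  unfolding near_def by (intro Y_finite) simp

lemma in_near:
  assumes "p \<in> SU11" "y \<in> Y" "act (su_inv p) y \<in> strip \<rho>" "\<bar>foot (act (su_inv p) y)\<bar> \<le> r" "su_norm p \<le> R"
  shows "y \<in> near r R"
  using strip_preimage_bound[OF assms(1) _ \<rho>_pos assms(3,4,5)] assms(2) Y_disc by (auto simp: near_def)

lemma finite_feet_window:
  assumes p: "p \<in> SU11"
  shows "finite (feet Y \<rho> p \<inter> {-r..r})"
proof (rule finite_subset)
  show "feet Y \<rho> p \<inter> {-r..r} \<subseteq> (\<lambda>y. foot (act (su_inv p) y)) ` near r (su_norm p)"
    using in_near[OF p] by (auto simp: feet_def)
  show "finite ((\<lambda>y. foot (act (su_inv p) y)) ` near r (su_norm p))"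
    using su_norm_ge_1[OF p] by (intro finite_imageI finite_near) simp
qed

text \<open>Pushing the geodesic slightly towards its positive side brings the points at distance
  exactly \<open>\<rho>\<close> on that side into the interior of the strip and expels those on the other side,
  so that membership in the strip becomes an open condition.\<close>
lemma feet_perturbation:
  assumes p0: "p0 \<in> SU11" and r: "r > 0"
  obtains p1 d where "p1 \<in> SU11" "d > 0"
    "\<And>p. p \<in> SU11 \<Longrightarrow> dist p p1 < d \<Longrightarrow> N_rel r (feet Y \<rho> p0) (feet Y \<rho> p)"
proof -
  \<comment> \<open>The 1 leaves room for all frames close to p0, so that the finite set F is common
    to them.\<close>
  define R where "R = su_norm p0 + 1"
  define F where "F = near r R"
  define h where "h = sinh \<rho>"
  define W where "W = (\<lambda>p y. act (su_inv p) y)"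
  have R: "R > 0" using su_norm_ge_1[OF p0] by (simp add: R_def)
  have F: "finite F" using finite_near[OF R] by (simp add: F_def)
  have Yd: "y \<in> disc" if "y \<in> F" for y using that Y_disc by (auto simp: F_def near_def)
  have tH: "((\<lambda>x. height (W (f x) y)) \<longlongrightarrow> height (W p y)) G"
    and tF: "((\<lambda>x. foot (W (f x) y)) \<longlongrightarrow> foot (W p y)) G"
    if "(f \<longlongrightarrow> p) G" "p \<in> SU11" "y \<in> F" for f p y and G :: "'x filter"
    unfolding W_def using that Yd
    by (auto intro!: tendsto_height tendsto_foot tendsto_act_inv)
  \<comment> \<open>The conditions on p that are open already at p0: strict inequalities between
    heights and the two thresholds persist.\<close>
  define P where "P = (\<lambda>p. su_norm p < R \<and> (\<forall>y\<in>F. dist (foot (W p y)) (foot (W p0 y)) < 1 / r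
      \<and> (height (W p0 y) > - h \<longrightarrow> height (W p y) > - h) \<and> (height (W p0 y) > h \<longrightarrow> height (W p y) > h)))"
  have id: "((\<lambda>p. p) \<longlongrightarrow> p0) (nhds p0)" by (rule filterlim_ident)
  have "((\<lambda>p. su_norm p) \<longlongrightarrow> su_norm p0) (nhds p0)"
    unfolding su_norm_def by (intro tendsto_intros id)
  then have "\<forall>\<^sub>F p in nhds p0. su_norm p < R" by (rule order_tendstoD) (simp add: R_def)
  moreover have "\<forall>\<^sub>F p in nhds p0. dist (foot (W p y)) (foot (W p0 y)) < 1 / r
      \<and> (height (W p0 y) > - h \<longrightarrow> height (W p y) > - h) \<and> (height (W p0 y) > h \<longrightarrow> height (W p y) > h)"
    if "y \<in> F" for y
    using tendstoD[OF tF[OF id p0 that], of "1 / r"] order_tendstoD(1)[OF tH[OF id p0 that]] r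
    by (intro eventually_conj eventually_imp_const) auto
  ultimately have "\<forall>\<^sub>F p in nhds p0. P p"
    unfolding P_def using F by (intro eventually_conj eventually_ball_finite) auto
  \<comment> \<open>P holds around each frame near p0, in particular around the pushed one.\<close>
  then have ev: "\<forall>\<^sub>F p in nhds p0. \<forall>\<^sub>F q in nhds p. P q" by (simp add: eventually_eventually)
  have "((\<lambda>t. p0 \<odot> push t) \<longlongrightarrow> p0 \<odot> push 0) (at_right 0)"
    unfolding su_mult_def push_def fst_conv snd_conv by (intro tendsto_intros) auto
  then have lim: "((\<lambda>t. p0 \<odot> push t) \<longlongrightarrow> p0) (at_right 0)"
    by (simp add: push_def flip: su_one_def)
  have "\<forall>\<^sub>F t in at_right 0. t > 0 \<and> (\<forall>\<^sub>F q in nhds (p0 \<odot> push t). P q)"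
    using lim[unfolded filterlim_iff, rule_format, OF ev] eventually_at_right_less
    by (intro eventually_conj)
  then obtain t :: real where t: "t > 0" "\<forall>\<^sub>F q in nhds (p0 \<odot> push t). P q"
    using eventually_happens'[OF trivial_limit_at_right_real] by blast
  define p1 where "p1 = p0 \<odot> push t"
  have p1: "p1 \<in> SU11" using p0 by (simp add: p1_def)
  have less: "height (W p1 y) < height (W p0 y)" if "y \<in> F" for y
    using height_push_less[OF _ t(1), of "W p0 y"] p0 Yd[OF that]
    by (simp add: W_def p1_def su_inv_mult act_mult)
  \<comment> \<open>By \<open>less\<close> the non-strict inequalities at p0 are strict at p1, hence
    open there. Together with P they decide membership in the strip in both directions.\<close>
  define Q where "Q = (\<lambda>p. P p \<and> (\<forall>y\<in>F. (height (W p0 y) \<le> h \<longrightarrow> height (W p y) < h)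
      \<and> (height (W p0 y) \<le> - h \<longrightarrow> height (W p y) < - h)))"
  have id1: "((\<lambda>p. p) \<longlongrightarrow> p1) (nhds p1)" by (rule filterlim_ident)
  have "\<forall>\<^sub>F p in nhds p1. (height (W p0 y) \<le> h \<longrightarrow> height (W p y) < h)
      \<and> (height (W p0 y) \<le> - h \<longrightarrow> height (W p y) < - h)" if "y \<in> F" for y
    using order_tendstoD(2)[OF tH[OF id1 p1 that]] less[OF that]
    by (intro eventually_conj eventually_imp_const) auto
  then have "\<forall>\<^sub>F p in nhds p1. Q p"
    unfolding Q_def using F t by (intro eventually_conj eventually_ball_finite) (auto simp: p1_def)
  then obtain d where d: "d > 0" "\<And>p. dist p p1 < d \<Longrightarrow> Q p" by (auto simp: eventually_nhds_metric)
  have "N_rel r (feet Y \<rho> p0) (feet Y \<rho> p)" if p: "p \<in> SU11" "dist p p1 < d" for p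
  proof -
    have Q: "Q p" by (rule d(2)[OF p(2)])
    have iff: "W p y \<in> strip \<rho> \<longleftrightarrow> W p0 y \<in> strip \<rho>" if "y \<in> F" for y
      using Q that unfolding Q_def P_def strip_def h_def[symmetric] by force
    have close: "\<bar>foot (W p y) - foot (W p0 y)\<bar> < 1 / r" if "y \<in> F" for y
      using Q that by (auto simp: Q_def P_def dist_real_def)
    have nrm: "su_norm p \<le> R" "su_norm p0 \<le> R" using Q by (auto simp: Q_def P_def R_def)
    have one: "feet Y \<rho> a \<inter> {-r<..<r} \<subseteq> {s + u |s u. s \<in> feet Y \<rho> b \<and> \<bar>u\<bar> < 1 / r}"
      if ab: "a \<in> SU11" "su_norm a \<le> R" "\<And>y. y \<in> F \<Longrightarrow> W a y \<in> strip \<rho> \<Longrightarrow> W b y \<in> strip \<rho>"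
        "\<And>y. y \<in> F \<Longrightarrow> \<bar>foot (W a y) - foot (W b y)\<bar> < 1 / r" for a b
    proof
      fix s assume "s \<in> feet Y \<rho> a \<inter> {-r<..<r}"
      then obtain y where y: "y \<in> Y" "W a y \<in> strip \<rho>" "s = foot (W a y)" "\<bar>s\<bar> \<le> r"
        by (auto simp: feet_def W_def)
      then have yF: "y \<in> F" unfolding F_def using ab by (intro in_near) (auto simp: W_def)
      then have "foot (W b y) \<in> feet Y \<rho> b" using y ab(3) by (auto simp: feet_def W_def)
      moreover have "s = foot (W b y) + (s - foot (W b y))" by simp
      ultimately show "s \<in> {s + u |s u. s \<in> feet Y \<rho> b \<and> \<bar>u\<bar> < 1 / r}"
        using ab(4)[OF yF] y(3) by blast
    qed
    show ?thesis unfolding N_rel_def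
      using one[OF p0 nrm(2), of p] one[OF p(1) nrm(1), of p0] iff close
      by (simp add: abs_minus_commute)
  qed
  then show ?thesis using that p1 d(1) by blast
qed

end

section \<open>Recurrence and closed geodesics\<close>

lemma den_mult:
  assumes "q \<in> SU11" "z \<in> disc"
  shows "den (p \<odot> q) z = den p (act q z) * den q z"
  using den_nonzero[OF assms] by (simp add: act_def su_mult_def den_def field_simps)

lemma has_field_derivative_act:
  assumes "p \<in> SU11" "z \<in> disc"
  shows "(act p has_field_derivative 1 / (den p z)\<^sup>2) (at z)"
proof -
  have d: "den p z \<noteq> 0" by (rule den_nonzero[OF assms])
  have "((\<lambda>z. (fst p * z + snd p) / (cnj (snd p) * z + cnj (fst p))) has_field_derivative
     (fst p * (cnj (snd p) * z + cnj (fst p)) - (fst p * z + snd p) * cnj (snd p)) / (den p z * den p z)) (at z)"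
    unfolding den_def by (rule derivative_eq_intros refl | use d in \<open>simp add: den_def\<close>)+
  moreover have "fst p * (cnj (snd p) * z + cnj (fst p)) - (fst p * z + snd p) * cnj (snd p) = 1"
    using su_det[OF assms(1)] by (simp add: algebra_simps)
  ultimately show ?thesis by (simp add: act_def[abs_def] den_def power2_eq_square)
qed

lemma deriv_mob:
  assumes "p \<in> SU11" "z \<in> disc"
  shows "deriv (mob (fst p) (snd p)) z = 1 / (den p z)\<^sup>2"
proof (rule DERIV_imp_deriv)
  show "(mob (fst p) (snd p) has_field_derivative 1 / (den p z)\<^sup>2) (at z)"
    by (rule has_field_derivative_transform_within_open[OF has_field_derivative_act[OF assms], of disc])
      (use assms in \<open>auto simp: disc_def mob_eq_act[unfolded disc_def]\<close>)
qed

lemma vector_derivative_act_std: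
  assumes "p \<in> SU11"
  shows "vector_derivative (\<lambda>s. act p (std_geod s)) (at t) = 1 / (2 * (den (p \<odot> boost t) 0)\<^sup>2)"
proof -
  have d: "((\<lambda>t. tanh (t/2)) has_field_derivative (1 / (2 * (cosh (t/2))\<^sup>2))) (at t)" for t :: real
    using one_minus_tanh_sq[of "t/2"] by (auto intro!: derivative_eq_intros)
  have "(std_geod has_vector_derivative of_real (1 / (2 * (cosh (t/2))\<^sup>2))) (at t)"
    unfolding std_geod_def[abs_def]
    by (rule has_vector_derivative_of_real[OF d])
  then have "(act p \<circ> std_geod has_vector_derivative
      of_real (1 / (2 * (cosh (t/2))\<^sup>2)) * (1 / (den p (std_geod t))\<^sup>2)) (at t)"
    by (rule field_vector_diff_chain_at[OF _ has_field_derivative_act[OF assms std_geod_in_disc]])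
  then have "vector_derivative (\<lambda>s. act p (std_geod s)) (at t)
      = of_real (1 / (2 * (cosh (t/2))\<^sup>2)) * (1 / (den p (std_geod t))\<^sup>2)"
    by (simp add: vector_derivative_at o_def)
  moreover have "act (boost t) 0 = std_geod t" using act_boost_std_geod[of t 0] by simp
  ultimately show ?thesis
    by (simp add: den_mult power_mult_distrib) (simp add: den_def boost_def)
qed

text \<open>The image under \<open>act p\<close> of the unit vector 1/2 at 0, whose hyperbolic
  length is 1; here den p 0 = cnj (fst p).\<close>

definition tangent :: "complex \<times> complex \<Rightarrow> complex \<times> complex" where
  "tangent p = (act p 0, 1 / (2 * (cnj (fst p))\<^sup>2))"

lemma tangent_in_unit_tangent:
  assumes "p \<in> SU11" shows "tangent p \<in> unit_tangent"
proof -
  have "fst p \<noteq> 0" using su_less(2)[OF assms] by auto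
  moreover have "1 - (cmod (act p 0))\<^sup>2 = 1 / (cmod (fst p))\<^sup>2"
    using one_minus_act[OF assms, of 0] by (simp add: den_def)
  ultimately have "2 * cmod (1 / (2 * (cnj (fst p))\<^sup>2)) / (1 - (cmod (act p 0))\<^sup>2) = 1"
    by (simp only: norm_divide norm_mult norm_power complex_mod_cnj) simp
  then show ?thesis using assms by (simp add: tangent_def unit_tangent_def)
qed

text \<open>The frame is determined by its tangent vector only up to sign, as \<open>PSU(1,1)\<close> acts simply
  transitively on unit tangent vectors.\<close>
lemma tangent_converges:
  assumes s: "\<And>n. s n \<in> SU11" and p: "p \<in> SU11"
    and lim: "(\<lambda>n. tangent (s n)) \<longlonglongrightarrow> tangent p"
  shows "\<exists>\<sigma>. (\<forall>n. \<sigma> n = s n \<or> \<sigma> n = - s n) \<and> \<sigma> \<longlonglongrightarrow> p"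
proof -
  \<comment> \<open>The sign for which the first entry is closer to that of p. Then |a' - a|^2 is at
    most |a' - a| * |a' + a| for either sign of a', so convergence of the squares suffices.\<close>
  define \<sigma> where "\<sigma> = (\<lambda>n. if cmod (fst (s n) - fst p) \<le> cmod (fst (s n) + fst p) then s n else - s n)"
  have a0: "fst p \<noteq> 0" using su_less(2)[OF p] by auto
  have an0: "fst (s n) \<noteq> 0" for n using su_less(2)[OF s, of n] by auto
  have lim2: "(\<lambda>n. 1 / (2 * (cnj (fst (s n)))\<^sup>2)) \<longlonglongrightarrow> 1 / (2 * (cnj (fst p))\<^sup>2)"
    using tendsto_snd[OF lim] by (simp add: tangent_def)
  have sq: "(\<lambda>n. (fst (s n))\<^sup>2) \<longlonglongrightarrow> (fst p)\<^sup>2"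
    using tendsto_cnj[OF tendsto_inverse[OF tendsto_mult_left[OF lim2, of 2]]] a0 by simp
  have bound: "(cmod (fst (\<sigma> n) - fst p))\<^sup>2 \<le> cmod ((fst (s n))\<^sup>2 - (fst p)\<^sup>2)" for n
  proof -
    have "cmod (fst (\<sigma> n) - fst p) \<le> cmod (fst (s n) - fst p)"
      "cmod (fst (\<sigma> n) - fst p) \<le> cmod (fst (s n) + fst p)"
      using norm_minus_cancel[of "fst (s n) + fst p"] by (auto simp: \<sigma>_def)
    then have "(cmod (fst (\<sigma> n) - fst p))\<^sup>2 \<le> cmod (fst (s n) - fst p) * cmod (fst (s n) + fst p)"
      unfolding power2_eq_square by (intro mult_mono) auto
    also have "\<dots> = cmod ((fst (s n))\<^sup>2 - (fst p)\<^sup>2)"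
      by (simp add: power2_eq_square algebra_simps flip: norm_mult)
    finally show ?thesis .
  qed
  have "(\<lambda>n. cmod ((fst (s n))\<^sup>2 - (fst p)\<^sup>2)) \<longlonglongrightarrow> 0"
    using sq by (simp add: LIM_zero_iff tendsto_norm_zero_iff)
  then have "(\<lambda>n. (cmod (fst (\<sigma> n) - fst p))\<^sup>2) \<longlonglongrightarrow> 0"
    by (rule Lim_null_comparison[rotated]) (use bound in auto)
  then have "(\<lambda>n. fst (\<sigma> n) - fst p) \<longlonglongrightarrow> 0"
    by (simp add: tendsto_norm_zero_iff)
  then have fst: "(\<lambda>n. fst (\<sigma> n)) \<longlonglongrightarrow> fst p" by (simp add: LIM_zero_iff)
  \<comment> \<open>The base point is snd p / cnj (fst p) and ignores the sign; it recovers the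
    second entry from the first.\<close>
  have "(\<lambda>n. act (s n) 0) \<longlonglongrightarrow> act p 0"
    using tendsto_fst[OF lim] by (simp add: tangent_def)
  then have "(\<lambda>n. act (s n) 0 * cnj (fst (\<sigma> n))) \<longlonglongrightarrow> act p 0 * cnj (fst p)"
    by (intro tendsto_intros fst)
  moreover have "act (s n) 0 * cnj (fst (\<sigma> n)) = snd (\<sigma> n)" for n
    using an0 by (simp add: \<sigma>_def act_def den_def)
  ultimately have "(\<lambda>n. snd (\<sigma> n)) \<longlonglongrightarrow> snd p" using a0 by (simp add: act_def den_def)
  from tendsto_Pair[OF fst this] have "\<sigma> \<longlonglongrightarrow> p" by simp
  then show ?thesis by (intro exI[of _ \<sigma>]) (simp add: \<sigma>_def)
qed

text \<open>Write N = \<alpha> + s X with X = (i u, w) and let B = (0, 1). Determinant 1 amounts to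
  |w|^2 = 1 + u^2, that is X X = 1, and also B B = 1, so X (1 + X B) = X + B = (1 + X B) B. Now 1 +
  X B = (1 + w, i u) has determinant k^2, and M is its normalisation. It carries the real diameter
  to the axis of N and is close to 1 when w is close to 1 and u to 0.\<close>

lemma hyperbolic_axis:
  fixes N
  defines "\<alpha> \<equiv> Re (fst N)"
  defines "s \<equiv> sqrt (\<alpha>\<^sup>2 - 1)"
  defines "w \<equiv> snd N / of_real s" and "u \<equiv> Im (fst N) / s"
  defines "k \<equiv> sqrt (2 + 2 * Re w)"
  defines "M \<equiv> ((1 + w) / of_real k, \<i> * of_real u / of_real k)"
  assumes N: "N \<in> SU11" and \<alpha>: "\<alpha> > 1" and w: "Re w > -1"
  shows "M \<in> SU11" "N \<odot> M = M \<odot> (of_real \<alpha>, of_real s)"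
proof -
  have s: "s > 0" "s\<^sup>2 = \<alpha>\<^sup>2 - 1" using \<alpha> by (simp_all add: s_def)
  have k: "k > 0" "k\<^sup>2 = 2 + 2 * Re w" using w by (simp_all add: k_def)
  have fN: "fst N = of_real \<alpha> + \<i> * of_real (s * u)"
    using s by (simp add: \<alpha>_def u_def complex_eq_iff)
  have sN: "snd N = of_real s * w" using s by (simp add: w_def)
  have "(\<alpha>\<^sup>2 + (s * u)\<^sup>2) - s\<^sup>2 * (cmod w)\<^sup>2 = 1"
    using N unfolding SU11_def mem_Collect_eq fN sN norm_mult power_mult_distrib[of _ "cmod w"]
    by (simp add: cmod_power2[of "_ + _"])
  then have "s\<^sup>2 * (cmod w)\<^sup>2 = s\<^sup>2 * (1 + u\<^sup>2)"
    using s(2) unfolding power_mult_distrib distrib_left by linarith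
  then have wu: "(cmod w)\<^sup>2 = 1 + u\<^sup>2" using s(1) by simp
  have "(cmod (1 + w))\<^sup>2 = 1 + 2 * Re w + (cmod w)\<^sup>2"
    unfolding cmod_power2 by (simp add: power2_eq_square algebra_simps)
  then have "(cmod (1 + w))\<^sup>2 - u\<^sup>2 = k\<^sup>2" using k wu by simp
  then show "M \<in> SU11"
    using k(1) by (simp add: SU11_def M_def norm_divide norm_mult power_divide flip: diff_divide_distrib)
  have ww: "w * cnj w = 1 + of_real (u\<^sup>2)"
    using wu by (metis complex_norm_square of_real_1 of_real_add)
  have "fst N * (1 + w) + snd N * cnj (\<i> * of_real u) = (1 + w) * of_real \<alpha> + \<i> * of_real u * of_real s"
    by (simp add: fN sN algebra_simps)
  moreover have "fst N * (\<i> * of_real u) + snd N * cnj (1 + w)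
      = (1 + w) * of_real s + \<i> * of_real u * of_real \<alpha>"
  proof -
    have "snd N * cnj (1 + w) = of_real s * w + of_real s * (w * cnj w)" by (simp add: sN algebra_simps)
    then show ?thesis unfolding ww by (simp add: fN algebra_simps power2_eq_square)
  qed
  moreover have "N \<odot> M = ((fst N * (1 + w) + snd N * cnj (\<i> * of_real u)) / of_real k,
      (fst N * (\<i> * of_real u) + snd N * cnj (1 + w)) / of_real k)"
    by (simp add: su_mult_def M_def diff_divide_distrib add_divide_distrib distrib_left)
  moreover have "M \<odot> (of_real \<alpha>, of_real s) = (((1 + w) * of_real \<alpha> + \<i> * of_real u * of_real s) / of_real k,
      ((1 + w) * of_real s + \<i> * of_real u * of_real \<alpha>) / of_real k)"
    by (simp add: su_mult_def M_def add_divide_distrib distrib_right)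
  ultimately show "N \<odot> M = M \<odot> (of_real \<alpha>, of_real s)" by simp
qed

lemma tendsto_su_mult [tendsto_intros]:
  "(f \<longlongrightarrow> p) F \<Longrightarrow> (g \<longlongrightarrow> q) F \<Longrightarrow> ((\<lambda>x. f x \<odot> g x) \<longlongrightarrow> p \<odot> q) F"
  unfolding su_mult_def by (intro tendsto_intros)

lemma tendsto_su_inv [tendsto_intros]:
  "(f \<longlongrightarrow> p) F \<Longrightarrow> ((\<lambda>x. su_inv (f x)) \<longlongrightarrow> su_inv p) F"
  unfolding su_inv_def by (intro tendsto_intros)

lemma su_norm_triangle: "su_norm p \<le> su_norm q + su_norm (p - q)"
  using norm_triangle_sub[of "fst p" "fst q"] norm_triangle_sub[of "snd p" "snd q"]
  by (simp add: su_norm_def)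

lemma inj_on_cis: "inj_on cis {0<..<1}"
proof (rule inj_onI)
  fix s t assume "s \<in> {0<..<1}" "t \<in> {0<..<1}" "cis s = cis t"
  then have "sin s = sin t" "\<bar>s\<bar> \<le> pi/2" "\<bar>t\<bar> \<le> pi/2"
    using pi_ge_two by (auto simp: complex_eq_iff)
  then show "s = t" using sin_inj_pi by (auto simp: abs_le_iff)
qed

section \<open>Visits of the dense geodesic to the neighbourhood of a frame\<close>

context fuchsian_group
begin

text \<open>By the chain rule the vectors in \<open>dense_geodesic\<close> are the tangent vectors
  of the frames \<open>q \<odot> (p \<odot> boost t)\<close>. The sign left open by
  \<open>tangent_converges\<close> goes into q.\<close>

lemma dense_frames:
  assumes p: "p \<in> SU11" and dense: "dense_geodesic \<Gamma> (\<lambda>s. act p (std_geod s))"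
    and p1: "p1 \<in> SU11" and d: "d > 0"
  obtains q t where "q \<in> lifts" "dist (q \<odot> (p \<odot> boost t)) p1 < d"
proof -
  let ?\<kappa> = "\<lambda>s. act p (std_geod s)"
  have tan: "\<exists>q\<in>lifts. (g (?\<kappa> t), deriv g (?\<kappa> t) * vector_derivative ?\<kappa> (at t)) = tangent (q \<odot> (p \<odot> boost t))"
    if "g \<in> \<Gamma>" for g t
  proof -
    obtain q where q: "q \<in> lifts" "g = mob (fst q) (snd q)" using lifts_surj[OF \<open>g \<in> \<Gamma>\<close>] .
    have q': "q \<in> SU11" using q by (simp add: lifts_SU11)
    have b: "act (boost t) 0 = std_geod t" using act_boost_std_geod[of t 0] by simp
    then have \<kappa>: "act (p \<odot> boost t) 0 = ?\<kappa> t" using p by (simp add: act_mult)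
    have "den (q \<odot> (p \<odot> boost t)) 0 = den q (?\<kappa> t) * den (p \<odot> boost t) 0"
      using p q' by (simp add: den_mult flip: \<kappa>)
    then have "cnj (fst (q \<odot> (p \<odot> boost t))) = den q (?\<kappa> t) * den (p \<odot> boost t) 0"
      by (simp only: den_def mult_zero_right add_0)
    then have "deriv g (?\<kappa> t) * vector_derivative ?\<kappa> (at t) = 1 / (2 * (cnj (fst (q \<odot> (p \<odot> boost t))))\<^sup>2)"
      unfolding q(2) vector_derivative_act_std[OF p] deriv_mob[OF q' act_in_disc[OF p std_geod_in_disc]]
      by (simp only: power_mult_distrib) simp
    moreover have "g (?\<kappa> t) = act (q \<odot> (p \<odot> boost t)) 0"
      using p q q' by (simp add: mob_eq_act act_mult b)
    ultimately show ?thesis using q by (auto simp: tangent_def)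
  qed
  have "tangent p1 \<in> closure {(g (?\<kappa> t), deriv g (?\<kappa> t) * vector_derivative ?\<kappa> (at t)) | g t. g \<in> \<Gamma>}"
    using dense tangent_in_unit_tangent[OF p1] by (auto simp: dense_geodesic_def)
  then obtain f where f: "\<And>n. f n \<in> {(g (?\<kappa> t), deriv g (?\<kappa> t) * vector_derivative ?\<kappa> (at t)) | g t. g \<in> \<Gamma>}"
    "f \<longlonglongrightarrow> tangent p1" unfolding closure_sequential by blast
  have "\<exists>q t. q \<in> lifts \<and> f n = tangent (q \<odot> (p \<odot> boost t))" for n
    using f(1)[of n] tan by force
  then obtain q t where qt: "\<And>n. q n \<in> lifts" "\<And>n. f n = tangent (q n \<odot> (p \<odot> boost (t n)))" by metis
  have "\<exists>\<sigma>. (\<forall>n. \<sigma> n = q n \<odot> (p \<odot> boost (t n)) \<or> \<sigma> n = - (q n \<odot> (p \<odot> boost (t n)))) \<and> \<sigma> \<longlonglongrightarrow> p1"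
    using qt(1) f(2) p p1 by (intro tangent_converges) (auto simp: lifts_SU11 simp flip: qt(2))
  then obtain \<sigma> where \<sigma>: "\<And>n. \<sigma> n = q n \<odot> (p \<odot> boost (t n)) \<or> \<sigma> n = - (q n \<odot> (p \<odot> boost (t n)))" "\<sigma> \<longlonglongrightarrow> p1"
    by blast
  obtain n where n: "dist (\<sigma> n) p1 < d"
    using tendstoD[OF \<sigma>(2) d] eventually_happens'[OF sequentially_bot] by blast
  have "\<sigma> n = q n \<odot> (p \<odot> boost (t n)) \<or> \<sigma> n = (- q n) \<odot> (p \<odot> boost (t n))"
    using \<sigma>(1)[of n] by (simp add: su_mult_minus)
  then show ?thesis using that n qt(1)[of n] lifts_minus by metis
qed

text \<open>A compact piece of the geodesic contributes finitely many arcs near \<open>p1\<close>, and these miss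
  almost all small rotations of \<open>p1\<close>.\<close>
lemma dense_frames_late:
  assumes p: "p \<in> SU11" and dense: "dense_geodesic \<Gamma> (\<lambda>s. act p (std_geod s))"
    and p1: "p1 \<in> SU11" and d: "d > 0"
  obtains q t where "q \<in> lifts" "\<bar>t\<bar> > T" "dist (q \<odot> (p \<odot> boost t)) p1 < d"
proof -
  \<comment> \<open>Bounds q when it moves a frame at time |t| <= T to within d of p1: q is the
    resulting frame times the inverse of \<open>p \<odot> boost t\<close>.\<close>
  define R where "R = (su_norm p1 + 2 * d) * (su_norm p * exp (T/2))"
  define F where "F = {q \<in> lifts. su_norm q \<le> R}"
  define Z where "Z = (\<Union>q\<in>F. (\<lambda>t. q \<odot> (p \<odot> boost t)) ` {-T..T})"
  have F: "finite F" by (simp add: F_def finite_lifts)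
  have "compact ((\<lambda>t. q \<odot> (p \<odot> boost t)) ` {-T..T})" for q
    unfolding su_mult_def boost_def
    by (intro compact_continuous_image continuous_intros) auto
  then have Z: "closed Z" unfolding Z_def using F by (intro compact_imp_closed compact_UN) auto
  have inF: "q \<in> F" if q: "q \<in> lifts" and t: "\<bar>t\<bar> \<le> T" and D: "dist (q \<odot> (p \<odot> boost t)) p1 < d" for q t
  proof -
    let ?s = "q \<odot> (p \<odot> boost t)"
    have "su_norm ?s \<le> su_norm p1 + su_norm (?s - p1)" by (rule su_norm_triangle)
    also have "\<dots> \<le> su_norm p1 + 2 * d"
      using su_norm_le_norm[of "?s - p1"] D by (simp add: dist_norm)
    finally have s: "su_norm ?s \<le> su_norm p1 + 2 * d" .
    have "su_norm (boost t) \<le> exp (T/2)" using su_norm_boost[of t] t by (simp add: order_trans)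
    then have "su_norm p * su_norm (boost t) \<le> su_norm p * exp (T/2)"
      by (intro mult_left_mono su_norm_nonneg)
    then have b: "su_norm (p \<odot> boost t) \<le> su_norm p * exp (T/2)"
      using su_norm_mult[of p "boost t"] by linarith
    have "q = ?s \<odot> su_inv (p \<odot> boost t)" using p by (subst su_mult_assoc) simp
    then have "su_norm q \<le> su_norm ?s * su_norm (p \<odot> boost t)"
      using su_norm_mult[of ?s "su_inv (p \<odot> boost t)"] by simp
    also have "\<dots> \<le> R" unfolding R_def
      using s b su_norm_nonneg order_trans[OF su_norm_nonneg s] by (intro mult_mono) auto
    finally show ?thesis using q by (simp add: F_def)
  qed
  \<comment> \<open>Rotations of p1 about its base point that stay within d.\<close>
  define U where "U = {u. cmod u = 1 \<and> dist (p1 \<odot> (u, 0)) p1 < d}"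
  have "infinite U"
  proof
    assume U: "finite U"
    have "((\<lambda>t. p1 \<odot> (cis t, 0)) \<longlongrightarrow> p1 \<odot> (cis 0, 0)) (at_right 0)"
      by (intro tendsto_intros)
    then have "((\<lambda>t. p1 \<odot> (cis t, 0)) \<longlongrightarrow> p1) (at_right 0)" by (simp flip: su_one_def)
    from tendstoD[OF this d] obtain b where b: "b > 0" "\<And>t. 0 < t \<Longrightarrow> t < b \<Longrightarrow> dist (p1 \<odot> (cis t, 0)) p1 < d"
      by (auto simp: eventually_at_right_field)
    have "inj_on cis {0<..<min b 1}" by (rule inj_on_subset[OF inj_on_cis]) auto
    moreover have "cis ` {0<..<min b 1} \<subseteq> U" using b by (auto simp: U_def)
    ultimately have "finite {0<..<min b 1}" using U by (metis finite_imageD finite_subset)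
    then show False using b(1) infinite_Ioo[of 0 "min b 1"] by simp
  qed
  have "\<exists>u\<in>U. p1 \<odot> (u, 0) \<notin> Z"
  proof (rule ccontr)
    assume "\<not> ?thesis"
    then have "\<forall>u\<in>U. \<exists>q\<in>F. \<exists>t. p1 \<odot> (u, 0) = q \<odot> (p \<odot> boost t)" by (force simp: Z_def)
    then obtain Q tt where Q: "\<And>u. u \<in> U \<Longrightarrow> Q u \<in> F" 
      "\<And>u. u \<in> U \<Longrightarrow> p1 \<odot> (u, 0) = Q u \<odot> (p \<odot> boost (tt u))" by metis
    have eq: "(u, 0) \<odot> boost (- tt u) = su_inv p1 \<odot> (Q u \<odot> p)" if "u \<in> U" for u
    proof -
      have "(u, 0) = su_inv p1 \<odot> (Q u \<odot> p) \<odot> boost (tt u)"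
        using Q(2)[OF that] p1 by (metis su_inv_left' su_mult_assoc)
      then show ?thesis by (simp add: su_mult_assoc boost_add)
    qed
    \<comment> \<open>Two rotations served by the same q lie on one flow line. Their first entries
      then differ by a positive factor, which is 1 as both have modulus 1.\<close>
    have "inj_on Q U"
    proof (rule inj_onI)
      fix u v assume uv: "u \<in> U" "v \<in> U" "Q u = Q v"
      then have "(u, 0) \<odot> boost (- tt u) = (v, 0) \<odot> boost (- tt v)" using eq by simp
      then have e: "u * of_real (cosh (tt u / 2)) = v * of_real (cosh (tt v / 2))"
        by (simp add: su_mult_def boost_def)
      then have "cmod u * cosh (tt u / 2) = cmod v * cosh (tt v / 2)"
        by (metis abs_of_pos cosh_real_pos norm_mult norm_of_real)
      then have "cosh (tt u / 2) = cosh (tt v / 2)" using uv unfolding U_def by simp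
      then show "u = v" using e cosh_real_pos[of "tt v / 2"] by (metis less_irrefl mult_cancel_right of_real_eq_0_iff)
    qed
    then show False using \<open>infinite U\<close> F Q(1) by (meson finite_imageD finite_subset image_subsetI)
  qed
  then obtain u where u: "cmod u = 1" "dist (p1 \<odot> (u, 0)) p1 < d" "p1 \<odot> (u, 0) \<notin> Z"
    by (auto simp: U_def)
  obtain e where e: "e > 0" "ball (p1 \<odot> (u, 0)) e \<subseteq> - Z"
    using u(3) Z open_contains_ball[of "- Z"] by auto
  \<comment> \<open>Aiming at the rotated frame, and closer than its distance to Z, rules out all
    times |t| <= T.\<close>
  obtain q t where qt: "q \<in> lifts" "dist (q \<odot> (p \<odot> boost t)) (p1 \<odot> (u, 0)) < min e (d - dist (p1 \<odot> (u, 0)) p1)"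
    using dense_frames[OF p dense, of "p1 \<odot> (u, 0)" "min e (d - dist (p1 \<odot> (u, 0)) p1)"] p1 u e
    by (auto simp: rot_in_SU11)
  have D: "dist (q \<odot> (p \<odot> boost t)) p1 < d"
    using qt(2) dist_triangle[of "q \<odot> (p \<odot> boost t)" p1 "p1 \<odot> (u, 0)"] by linarith
  have "\<bar>t\<bar> > T"
  proof (rule ccontr)
    assume "\<not> ?thesis"
    then have t: "\<bar>t\<bar> \<le> T" by simp
    then have "q \<odot> (p \<odot> boost t) \<in> Z" using inF[OF qt(1) t D] by (force simp: Z_def abs_le_iff)
    moreover have "q \<odot> (p \<odot> boost t) \<in> ball (p1 \<odot> (u, 0)) e" using qt(2) by (simp add: dist_commute)
    then have "q \<odot> (p \<odot> boost t) \<in> - Z" using e(2) by blast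
    ultimately show False by simp
  qed
  then show ?thesis using that qt(1) D by blast
qed

end

section \<open>The closing lemma\<close>

context fuchsian_group
begin

text \<open>Two visits near p1, by lifts q and q' at times t and t', give the lift q q'^{-1} with L
  = t' - t. The second visit is taken so late that t' - t or t - t' exceeds T; in the other case the
  visits swap roles.\<close>

lemma almost_returning_frames:
  assumes p: "p \<in> SU11" and dense: "dense_geodesic \<Gamma> (\<lambda>s. act p (std_geod s))"
    and p1: "p1 \<in> SU11" and d: "d > 0"
  obtains s s' L where "s \<in> SU11" "s' \<in> SU11" "dist s p1 < d" "dist s' p1 < d" "L > T"
    "s \<odot> boost L \<odot> su_inv s' \<in> lifts"
proof -
  have ret: "q \<odot> (p \<odot> boost t) \<odot> boost (t' - t) \<odot> su_inv (q' \<odot> (p \<odot> boost t')) \<in> lifts"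
    if "q \<in> lifts" "q' \<in> lifts" for q q' t t'
  proof -
    have "q \<odot> (p \<odot> boost t) \<odot> boost (t' - t) \<odot> su_inv (q' \<odot> (p \<odot> boost t'))
        = q \<odot> ((p \<odot> boost t') \<odot> (su_inv (p \<odot> boost t') \<odot> su_inv q'))"
      by (simp only: su_inv_mult[of q'] su_mult_assoc boost_add) (simp flip: su_mult_assoc add: boost_add)
    also have "\<dots> = q \<odot> su_inv q'" using p by (subst su_inv_right') auto
    finally show ?thesis using that by (simp add: lifts_mult lifts_inv)
  qed
  obtain q t where q: "q \<in> lifts" "dist (q \<odot> (p \<odot> boost t)) p1 < d"
    using dense_frames[OF p dense p1 d] .
  obtain q' t' where q': "q' \<in> lifts" "\<bar>t'\<bar> > \<bar>t\<bar> + \<bar>T\<bar>" "dist (q' \<odot> (p \<odot> boost t')) p1 < d"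
    using dense_frames_late[OF p dense p1 d] .
  have "t' - t > T \<or> t - t' > T" using q'(2) by linarith
  then show ?thesis
  proof
    assume "t' - t > T"
    then show ?thesis
      by (intro that[OF _ _ q(2) q'(3) _ ret]) (use p q q' in \<open>auto simp: lifts_SU11\<close>)
  next
    assume "t - t' > T"
    then show ?thesis
      by (intro that[OF _ _ q'(3) q(2) _ ret]) (use p q q' in \<open>auto simp: lifts_SU11\<close>)
  qed
qed

text \<open>Closing lemma: if the frame \<open>p1\<close> almost returns to itself under \<open>\<gamma>\<close> after a long time, then
  \<open>p1\<inverse>\<gamma>p1\<close>, rescaled by \<open>1 / cosh (L/2)\<close>, is close to the all-ones matrix, so that \<open>\<gamma>\<close> is
  hyperbolic with axis close to the geodesic of \<open>p1\<close>.\<close>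
lemma closed_geodesics_dense:
  assumes p: "p \<in> SU11" and dense: "dense_geodesic \<Gamma> (\<lambda>s. act p (std_geod s))"
    and p1: "p1 \<in> SU11" and d: "d > 0"
  obtains p' q L where "p' \<in> SU11" "dist p' p1 < d" "q \<in> lifts" "L > 0" "q \<odot> p' = p' \<odot> boost L"
proof -
  have "\<exists>s s' L. s \<in> SU11 \<and> s' \<in> SU11 \<and> dist s p1 < inverse (Suc n) \<and> dist s' p1 < inverse (Suc n) \<and> L > real n
    \<and> s \<odot> boost L \<odot> su_inv s' \<in> lifts" for n
    using almost_returning_frames[OF p dense p1, of "inverse (Suc n)" "real n"] by (metis of_nat_0_less_iff positive_imp_inverse_positive zero_less_Suc)
  then obtain s s' L where s: "\<And>n. s n \<in> SU11" "\<And>n. s' n \<in> SU11" "\<And>n. dist (s n) p1 < inverse (Suc n)"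
    "\<And>n. dist (s' n) p1 < inverse (Suc n)" "\<And>n. L n > real n" "\<And>n. s n \<odot> boost (L n) \<odot> su_inv (s' n) \<in> lifts"
    by metis
  have lim: "x \<longlonglongrightarrow> p1" if "\<And>n. dist (x n) p1 < inverse (Suc n)" for x
  proof -
    have "(\<lambda>n. dist (x n) p1) \<longlonglongrightarrow> 0"
      by (rule tendsto_sandwich[OF _ _ tendsto_const LIMSEQ_inverse_real_of_nat])
        (use that in \<open>auto intro!: always_eventually less_imp_le\<close>)
    then show ?thesis using tendsto_dist_iff by blast
  qed
  \<comment> \<open>The returning element, conjugated into the frame p1.\<close>
  define N where "N = (\<lambda>n. su_inv p1 \<odot> (s n \<odot> boost (L n) \<odot> su_inv (s' n)) \<odot> p1)"
  define c where "c = (\<lambda>n. cosh (L n / 2))"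
  \<comment> \<open>N divided by the real factor cosh (L/2). Its limit (1, 1) lies outside SU(1,1),
    but the product formula is still continuous there.\<close>
  define N' where "N' = (\<lambda>n. (su_inv p1 \<odot> s n) \<odot> ((1, of_real (tanh (L n / 2))) \<odot> (su_inv (s' n) \<odot> p1)))"
  have N_SU: "N n \<in> SU11" for n using s p1 by (simp add: N_def)
  have c: "c n > 0" for n by (simp add: c_def)
  have Linf: "filterlim (\<lambda>n. L n / 2) at_top sequentially"
  proof (rule filterlim_at_top_mono)
    show "filterlim (\<lambda>n. real n * (1/2)) at_top sequentially"
      by (intro filterlim_at_top_mult_tendsto_pos[OF tendsto_const] filterlim_real_sequentially) simp
  qed (use s(5) in \<open>auto intro!: always_eventually less_imp_le\<close>)
  have "(\<lambda>n. inverse (c n)) \<longlonglongrightarrow> 0"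
    unfolding c_def by (intro tendsto_inverse_0_at_top filterlim_compose[OF cosh_real_at_top Linf])
  then have c0: "(\<lambda>n. (inverse (c n))\<^sup>2) \<longlonglongrightarrow> 0" using tendsto_power[of _ 0 _ 2] by fastforce
  have tanh1: "(\<lambda>n. tanh (L n / 2)) \<longlonglongrightarrow> 1"
    by (rule filterlim_compose[OF tanh_real_at_top Linf])
  have "N' \<longlonglongrightarrow> (su_inv p1 \<odot> p1) \<odot> ((1, of_real 1) \<odot> (su_inv p1 \<odot> p1))"
    unfolding N'_def by (intro tendsto_intros tanh1 lim s)
  then have N'_lim: "N' \<longlonglongrightarrow> (1, 1)" using p1 by simp
  have N_N': "fst (N n) = of_real (c n) * fst (N' n)" "snd (N n) = of_real (c n) * snd (N' n)" for n
  proof -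
    have sc: "(of_real k * fst x, of_real k * snd x) \<odot> y = (of_real k * fst (x \<odot> y), of_real k * snd (x \<odot> y))"
      "y \<odot> (of_real k * fst x, of_real k * snd x) = (of_real k * fst (y \<odot> x), of_real k * snd (y \<odot> x))" for k x y
      by (simp_all add: su_mult_def algebra_simps)
    have "boost (L n) = (of_real (c n) * fst (1 :: complex, complex_of_real (tanh (L n / 2))), of_real (c n) * snd (1 :: complex, complex_of_real (tanh (L n / 2))))"
      by (simp add: boost_def c_def tanh_def)
    moreover have "N n = (su_inv p1 \<odot> s n) \<odot> (boost (L n) \<odot> (su_inv (s' n) \<odot> p1))"
      by (simp add: N_def su_mult_assoc)
    ultimately have "N n = (of_real (c n) * fst (N' n), of_real (c n) * snd (N' n))"
      unfolding N'_def by (simp only: sc)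
    then show "fst (N n) = of_real (c n) * fst (N' n)" "snd (N n) = of_real (c n) * snd (N' n)" by simp_all
  qed
  define \<alpha> where "\<alpha> = (\<lambda>n. Re (fst (N n)))"
  define \<sigma> where "\<sigma> = (\<lambda>n. sqrt ((\<alpha> n)\<^sup>2 - 1))"
  define w u where "w = (\<lambda>n. snd (N n) / of_real (\<sigma> n))" and "u = (\<lambda>n. Im (fst (N n)) / \<sigma> n)"
  define M where "M = (\<lambda>n. ((1 + w n) / of_real (sqrt (2 + 2 * Re (w n))),
      \<i> * of_real (u n) / of_real (sqrt (2 + 2 * Re (w n)))))"
  \<comment> \<open>The factor c n cancels in w and u, so their limits are those of the rescaled
    quantities.\<close>
  define \<sigma>' where "\<sigma>' = (\<lambda>n. sqrt ((Re (fst (N' n)))\<^sup>2 - (inverse (c n))\<^sup>2))"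
  have \<sigma>: "\<sigma> n = c n * \<sigma>' n" for n
  proof -
    have "(\<alpha> n)\<^sup>2 - 1 = (c n)\<^sup>2 * ((Re (fst (N' n)))\<^sup>2 - (inverse (c n))\<^sup>2)"
      using c[of n] by (simp add: \<alpha>_def N_N' field_simps)
    then show ?thesis using c[of n] by (simp add: \<sigma>_def \<sigma>'_def real_sqrt_mult)
  qed
  have \<sigma>': "\<sigma>' \<longlonglongrightarrow> 1"
  proof -
    have "\<sigma>' \<longlonglongrightarrow> sqrt ((Re (fst (1::complex, 1::complex)))\<^sup>2 - 0)"
      unfolding \<sigma>'_def by (intro tendsto_intros N'_lim c0)
    then show ?thesis by simp
  qed
  have "w = (\<lambda>n. snd (N' n) / of_real (\<sigma>' n))" "u = (\<lambda>n. Im (fst (N' n)) / \<sigma>' n)"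
    using c by (auto simp: w_def u_def \<sigma> N_N' fun_eq_iff less_imp_neq[symmetric])
  moreover have "(\<lambda>n. snd (N' n) / of_real (\<sigma>' n)) \<longlonglongrightarrow> snd (1::complex, 1::complex) / of_real 1"
    "(\<lambda>n. Im (fst (N' n)) / \<sigma>' n) \<longlonglongrightarrow> Im (fst (1::complex, 1::complex)) / 1"
    by (intro tendsto_intros N'_lim \<sigma>'; simp)+
  ultimately have w: "w \<longlonglongrightarrow> 1" and u: "u \<longlonglongrightarrow> 0" by simp_all
  have "M \<longlonglongrightarrow> ((1 + 1) / of_real (sqrt (2 + 2 * Re 1)), \<i> * of_real 0 / of_real (sqrt (2 + 2 * Re 1)))"
    unfolding M_def by (intro tendsto_intros w u) auto
  then have "M \<longlonglongrightarrow> su_one" by (simp add: su_one_def)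
  then have "(\<lambda>n. p1 \<odot> M n) \<longlonglongrightarrow> p1 \<odot> su_one" by (intro tendsto_intros)
  then have M: "\<forall>\<^sub>F n in sequentially. dist (p1 \<odot> M n) p1 < d" using tendstoD[OF _ d] by simp
  have "(\<lambda>n. Re (w n)) \<longlonglongrightarrow> Re 1" by (intro tendsto_intros w)
  then have w1: "\<forall>\<^sub>F n in sequentially. Re (w n) > -1" by (rule order_tendstoD) simp
  have "(\<lambda>n. Re (fst (N' n))) \<longlonglongrightarrow> Re (fst (1::complex, 1::complex))" by (intro tendsto_intros N'_lim)
  then have "filterlim (\<lambda>n. Re (fst (N' n)) * c n) at_top sequentially"
    unfolding c_def by (intro filterlim_tendsto_pos_mult_at_top[OF _ _ filterlim_compose[OF cosh_real_at_top Linf]]) auto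
  then have "\<forall>\<^sub>F n in sequentially. Re (fst (N' n)) * c n > 1" by (simp add: filterlim_at_top_dense)
  then have \<alpha>1: "\<forall>\<^sub>F n in sequentially. \<alpha> n > 1" by (simp add: \<alpha>_def N_N' mult.commute)
  obtain n where n: "dist (p1 \<odot> M n) p1 < d" "Re (w n) > -1" "\<alpha> n > 1"
    using eventually_happens'[OF sequentially_bot eventually_conj[OF M eventually_conj[OF w1 \<alpha>1]]] by blast
  have ax: "M n \<in> SU11" "N n \<odot> M n = M n \<odot> (of_real (\<alpha> n), of_real (\<sigma> n))"
    using hyperbolic_axis[OF N_SU[of n]] n unfolding \<alpha>_def \<sigma>_def w_def u_def M_def by auto
  \<comment> \<open>Twice the argument, as \<open>boost\<close> halves its parameter.\<close>
  define len where "len = 2 * arcosh (\<alpha> n)"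
  have len: "len > 0" "boost len = (of_real (\<alpha> n), of_real (\<sigma> n))"
    using n(3) by (auto simp: len_def boost_def sinh_arcosh_real \<sigma>_def)
  define q where "q = s n \<odot> boost (L n) \<odot> su_inv (s' n)"
  have "q \<odot> (p1 \<odot> M n) = p1 \<odot> (N n \<odot> M n)"
    using p1 unfolding N_def q_def[symmetric] by (simp add: su_mult_assoc)
  also have "\<dots> = (p1 \<odot> M n) \<odot> boost len" by (simp add: ax(2) len(2) su_mult_assoc)
  finally have "q \<odot> (p1 \<odot> M n) = (p1 \<odot> M n) \<odot> boost len" .
  then show ?thesis using that[of "p1 \<odot> M n" q len] p1 ax(1) n(1) s(6)[of n] len(1) by (simp add: q_def)
qed

end

section \<open>The local rubber topology\<close>

lemma N_rel_iff:
  "N_rel r S S' \<longleftrightarrow> (\<forall>s\<in>S. \<bar>s\<bar> < r \<longrightarrow> (\<exists>s'\<in>S'. \<bar>s - s'\<bar> < 1 / r))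
    \<and> (\<forall>s\<in>S'. \<bar>s\<bar> < r \<longrightarrow> (\<exists>s'\<in>S. \<bar>s - s'\<bar> < 1 / r))"
proof -
  have fatten: "t \<in> {s + u |s u. s \<in> B \<and> \<bar>u\<bar> < 1 / r} \<longleftrightarrow> (\<exists>s\<in>B. \<bar>t - s\<bar> < 1 / r)" for t B
  proof
    assume "\<exists>s\<in>B. \<bar>t - s\<bar> < 1 / r"
    then obtain s where "s \<in> B" "\<bar>t - s\<bar> < 1 / r" "t = s + (t - s)" by auto
    then show "t \<in> {s + u |s u. s \<in> B \<and> \<bar>u\<bar> < 1 / r}" by blast
  qed (auto intro: rev_bexI)
  have "A \<inter> {-r<..<r} \<subseteq> {s + u |s u. s \<in> B \<and> \<bar>u\<bar> < 1 / r}
      \<longleftrightarrow> (\<forall>s\<in>A. \<bar>s\<bar> < r \<longrightarrow> (\<exists>s'\<in>B. \<bar>s - s'\<bar> < 1 / r))" for A B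
    unfolding subset_iff fatten by (auto simp: abs_less_iff minus_less_iff)
  then show ?thesis unfolding N_rel_def by blast
qed

lemma N_rel_mono:
  assumes "N_rel r' S S'" "0 < r" "r \<le> r'" shows "N_rel r S S'"
proof -
  have "1 / r' \<le> 1 / r" using assms by (simp add: frac_le)
  then show ?thesis using assms(1,3) unfolding N_rel_iff by (meson less_le_trans)
qed

lemma openin_rubber:
  "openin (rubber \<epsilon> \<delta>) U \<longleftrightarrow> U \<subseteq> Del \<epsilon> \<delta> \<and> (\<forall>S\<in>U. \<exists>r>0. {S' \<in> Del \<epsilon> \<delta>. N_rel r S S'} \<subseteq> U)"
proof -
  have "istopology (\<lambda>U. U \<subseteq> Del \<epsilon> \<delta> \<and> (\<forall>S\<in>U. \<exists>r>0. {S' \<in> Del \<epsilon> \<delta>. N_rel r S S'} \<subseteq> U))" (is "istopology ?P")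
    unfolding istopology_def
  proof (intro conjI allI impI)
    fix U V assume U: "?P U" and V: "?P V"
    show "U \<inter> V \<subseteq> Del \<epsilon> \<delta>" using U by blast
    show "\<forall>S\<in>U \<inter> V. \<exists>r>0. {S' \<in> Del \<epsilon> \<delta>. N_rel r S S'} \<subseteq> U \<inter> V"
    proof
      fix S assume "S \<in> U \<inter> V"
      then obtain r r' where r: "r > 0" "{S' \<in> Del \<epsilon> \<delta>. N_rel r S S'} \<subseteq> U" "r' > 0" "{S' \<in> Del \<epsilon> \<delta>. N_rel r' S S'} \<subseteq> V"
        using U V by (meson IntD1 IntD2)
      then have "{S' \<in> Del \<epsilon> \<delta>. N_rel (max r r') S S'} \<subseteq> U \<inter> V"
        using N_rel_mono[of "max r r'" S _ r] N_rel_mono[of "max r r'" S _ r'] by auto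
      then show "\<exists>r>0. {S' \<in> Del \<epsilon> \<delta>. N_rel r S S'} \<subseteq> U \<inter> V"
        using r(1) by (intro exI[of _ "max r r'"]) auto
    qed
  next
    fix \<K> assume \<K>: "\<forall>K\<in>\<K>. ?P K"
    show "\<Union>\<K> \<subseteq> Del \<epsilon> \<delta>" using \<K> by blast
    show "\<forall>S\<in>\<Union>\<K>. \<exists>r>0. {S' \<in> Del \<epsilon> \<delta>. N_rel r S S'} \<subseteq> \<Union>\<K>" using \<K> by (meson Union_iff Union_upper subset_trans)
  qed
  then show ?thesis unfolding rubber_def by (simp add: topology_inverse')
qed

lemma topspace_rubber: "topspace (rubber \<epsilon> \<delta>) = Del \<epsilon> \<delta>"
proof -
  have "openin (rubber \<epsilon> \<delta>) (Del \<epsilon> \<delta>)" unfolding openin_rubber by (auto intro: exI[of _ 1])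
  then show ?thesis unfolding topspace_def openin_rubber by (intro subset_antisym) auto
qed

lemma in_rubber_closure:
  assumes S: "S \<in> Del \<epsilon> \<delta>" and X: "\<And>r. r > 0 \<Longrightarrow> \<exists>S'\<in>X. S' \<in> Del \<epsilon> \<delta> \<and> N_rel r S S'"
  shows "S \<in> rubber \<epsilon> \<delta> closure_of X"
  unfolding in_closure_of topspace_rubber
proof (intro conjI S allI impI)
  fix U assume "S \<in> U \<and> openin (rubber \<epsilon> \<delta>) U"
  then obtain r where "r > 0" "{S' \<in> Del \<epsilon> \<delta>. N_rel r S S'} \<subseteq> U" unfolding openin_rubber by blast
  then show "\<exists>S'. S' \<in> X \<and> S' \<in> U" using X[of r] by blast
qed

section \<open>Translations and periodic orbits\<close>

lemma in_translate_iff: "t \<in> translate S v \<longleftrightarrow> t + v \<in> S"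
  by (force simp: translate_def)

lemma translate_translate: "translate (translate S a) b = translate S (a + b)"
  by (auto simp: in_translate_iff add_ac)

lemma translate_0 [simp]: "translate S 0 = S"
  by (simp add: translate_def)

lemma translate_in_Del:
  assumes "S \<in> Del \<epsilon> \<delta>" shows "translate S v \<in> Del \<epsilon> \<delta>"
proof -
  have dense: "\<exists>s\<in>translate S v. \<bar>y - s\<bar> \<le> \<epsilon>" for y
  proof -
    have "\<exists>s\<in>S. \<bar>(y + v) - s\<bar> \<le> \<epsilon>" using assms unfolding Del_def delone_with_def by blast
    then obtain s where "s \<in> S" "\<bar>(y + v) - s\<bar> \<le> \<epsilon>" by blast
    then show ?thesis by (intro bexI[of _ "s - v"]) (auto simp: in_translate_iff algebra_simps)
  qed
  have "\<delta> \<le> \<bar>s - s'\<bar>" if ss: "s \<in> translate S v" "s' \<in> translate S v" "s \<noteq> s'" for s s'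
  proof -
    have "s + v \<in> S" "s' + v \<in> S" "s + v \<noteq> s' + v" using ss by (auto simp: in_translate_iff)
    then have "\<delta> \<le> \<bar>(s + v) - (s' + v)\<bar>" using assms unfolding Del_def delone_with_def by blast
    then show ?thesis by simp
  qed
  then show ?thesis using dense by (simp add: Del_def delone_with_def)
qed

lemma N_rel_translate:
  assumes "\<bar>v - v'\<bar> < 1 / r" shows "N_rel r (translate S v) (translate S v')"
proof -
  have "\<exists>s'\<in>translate S b. \<bar>s - s'\<bar> < 1 / r" if "\<bar>a - b\<bar> < 1 / r" "s \<in> translate S a" for a b s
    by (rule bexI[of _ "s + a - b"]) (use that in \<open>auto simp: in_translate_iff abs_minus_commute\<close>)
  then show ?thesis using assms unfolding N_rel_iff by (metis abs_minus_commute)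
qed

lemma translate_multiple:
  assumes "translate S L = S" shows "translate S (of_int k * L) = S"
proof (induction k rule: int_induct[where k = 0])
  case (step1 i)
  then show ?case using assms translate_translate[of S "of_int i * L" L] by (simp add: distrib_right)
next
  case (step2 i)
  have "translate S (of_int (i - 1) * L) = translate (translate S L) (of_int (i - 1) * L)" using assms by simp
  also have "\<dots> = translate S (of_int i * L)" by (simp add: translate_translate algebra_simps)
  finally show ?case using step2 by simp
qed simp

text \<open>Translation is continuous in its parameter, so the orbit is a continuous image of the
  compact interval {0..L}.\<close>

lemma periodic_in_if_translate_eq:
  assumes S: "S \<in> Del \<epsilon> \<delta>" and L: "L > 0" "translate S L = S"
  shows "periodic_in \<epsilon> \<delta> S"
proof -
  have "continuous_map euclideanreal (rubber \<epsilon> \<delta>) (translate S)"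
    unfolding continuous_map_def topspace_rubber
  proof (intro conjI allI impI)
    show "translate S \<in> topspace euclideanreal \<rightarrow> Del \<epsilon> \<delta>" using translate_in_Del[OF S] by auto
    fix U assume U: "openin (rubber \<epsilon> \<delta>) U"
    have "\<exists>e>0. ball v e \<subseteq> {v. translate S v \<in> U}" if v: "translate S v \<in> U" for v
    proof -
      obtain r where r: "r > 0" "{S' \<in> Del \<epsilon> \<delta>. N_rel r (translate S v) S'} \<subseteq> U"
        using bspec[OF conjunct2[OF U[unfolded openin_rubber]] v] by blast
      then have "ball v (1 / r) \<subseteq> {v. translate S v \<in> U}"
        using N_rel_translate[of v _ r S] translate_in_Del[OF S] by (auto simp: dist_real_def)
      then show ?thesis using r(1) by (intro exI[of _ "1 / r"]) auto
    qed
    then show "openin euclideanreal {v \<in> topspace euclideanreal. translate S v \<in> U}"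
      by (simp add: open_contains_ball)
  qed
  then have "compactin (rubber \<epsilon> \<delta>) (translate S ` {0..L})"
    by (rule image_compactin[rotated]) simp
  moreover have "translate S ` {0..L} = orb S"
  proof
    show "orb S \<subseteq> translate S ` {0..L}"
    proof
      fix T assume "T \<in> orb S"
      then obtain v where T: "T = translate S v" by (auto simp: orb_def)
      define k where "k = \<lfloor>v / L\<rfloor>"
      have "of_int k \<le> v / L" "v / L \<le> of_int k + 1" by (simp_all add: k_def)
      then have "v - of_int k * L \<in> {0..L}" using L(1) by (simp add: field_simps)
      moreover have "T = translate S (v - of_int k * L)"
        using translate_multiple[OF L(2), of k] translate_translate[of S "of_int k * L" "v - of_int k * L"]
        by (simp add: T)
      ultimately show "T \<in> translate S ` {0..L}" by blast
    qed
  qed (auto simp: orb_def)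
  ultimately show ?thesis using S by (simp add: periodic_in_def)
qed

lemma finite_uniform_gap:
  fixes f :: "'a \<Rightarrow> real"
  assumes "finite A" "\<And>a. a \<in> A \<Longrightarrow> c < f a"
  obtains \<eta> where "\<eta> > 0" "\<And>a. a \<in> A \<Longrightarrow> c + \<eta> \<le> f a"
proof
  \<comment> \<open>The 1 keeps the minimum defined for empty A.\<close>
  define \<eta> where "\<eta> = Min (insert 1 ((\<lambda>a. f a - c) ` A))"
  show "\<eta> > 0" using assms by (auto simp: \<eta>_def)
  show "c + \<eta> \<le> f a" if "a \<in> A" for a
  proof -
    have "\<eta> \<le> f a - c" unfolding \<eta>_def using assms(1) that by (intro Min_le) auto
    then show ?thesis by simp
  qed
qed

lemma small_radius:
  fixes a b :: real assumes "b > 0" obtains r where "r > a" "r > 0" "1 / r < b"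
proof
  define r where "r = max \<bar>a\<bar> (1 / b) + 1"
  show "r > a" "r > 0" by (auto simp: r_def)
  have "1 / b < r" by (simp add: r_def)
  then show "1 / r < b" using assms \<open>r > 0\<close> by (simp add: field_simps)
qed

text \<open>Approximation yields each Delone inequality up to an error 2/r or less. Local finiteness
  of T removes the error in relative density, since a strict inequality on a finite window has a
  uniform gap.\<close>

lemma Del_limit:
  assumes S: "S \<in> Del \<epsilon> \<delta>"
    and fin: "\<And>r. finite (T \<inter> {-r..r})"
    and lim: "\<And>r. r > 0 \<Longrightarrow> \<exists>v. N_rel r T (translate S v)"
  shows "T \<in> Del \<epsilon> \<delta>"
proof -
  have "\<exists>s\<in>T. \<bar>y - s\<bar> \<le> \<epsilon>" for y
  proof (rule ccontr)
    assume "\<not> ?thesis"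
    then have far: "\<epsilon> < \<bar>y - s\<bar>" if "s \<in> T" for s using that by auto
    \<comment> \<open>Large enough for every point of T within 1 of a point that is within
      \<epsilon> of y.\<close>
    define A where "A = T \<inter> {- (\<bar>y\<bar> + \<epsilon> + 1)..\<bar>y\<bar> + \<epsilon> + 1}"
    have "finite A" unfolding A_def by (rule fin)
    then obtain \<eta> where \<eta>: "\<eta> > 0" "\<And>s. s \<in> A \<Longrightarrow> \<epsilon> + \<eta> \<le> \<bar>y - s\<bar>"
      using finite_uniform_gap[of A \<epsilon> "\<lambda>s. \<bar>y - s\<bar>"] far unfolding A_def by blast
    obtain r where r: "r > \<bar>y\<bar> + \<epsilon>" "r > 0" "1 / r < min \<eta> 1"
      using small_radius[of "min \<eta> 1" "\<bar>y\<bar> + \<epsilon>"] \<eta>(1) by auto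
    obtain v where v: "N_rel r T (translate S v)" using lim[OF r(2)] by blast
    obtain s' where s': "s' \<in> translate S v" "\<bar>y - s'\<bar> \<le> \<epsilon>"
      using translate_in_Del[OF S, of v] unfolding Del_def delone_with_def by blast
    have "\<bar>s'\<bar> < r" using s'(2) r(1) by linarith
    then obtain s where s: "s \<in> T" "\<bar>s' - s\<bar> < 1 / r" using v s'(1) unfolding N_rel_iff by blast
    have "s \<in> A" using s s'(2) r(3) by (auto simp: A_def)
    then show False using \<eta>(2)[of s] s(2) s'(2) r(3) by auto
  qed
  moreover have "\<delta> \<le> \<bar>s - s'\<bar>" if ss: "s \<in> T" "s' \<in> T" "s \<noteq> s'" for s s'
  proof (rule ccontr)
    assume "\<not> ?thesis"
    \<comment> \<open>The first term of the minimum keeps the approximants of s and s' distinct, the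
      second keeps their distance below \<delta>.\<close>
    then obtain r where r: "r > max \<bar>s\<bar> \<bar>s'\<bar>" "r > 0" "1 / r < min \<bar>s - s'\<bar> (\<delta> - \<bar>s - s'\<bar>) / 2"
      using small_radius[of "min \<bar>s - s'\<bar> (\<delta> - \<bar>s - s'\<bar>) / 2" "max \<bar>s\<bar> \<bar>s'\<bar>"] ss(3) by auto
    obtain v where v: "N_rel r T (translate S v)" using lim[OF r(2)] by blast
    obtain a a' where a: "a \<in> translate S v" "\<bar>s - a\<bar> < 1 / r" "a' \<in> translate S v" "\<bar>s' - a'\<bar> < 1 / r"
      using v ss(1,2) r(1) unfolding N_rel_iff by (metis max_less_iff_conj)
    have "a \<noteq> a'" using a r(3) by auto
    then have "\<delta> \<le> \<bar>a - a'\<bar>" using translate_in_Del[OF S] a by (auto simp: Del_def delone_with_def)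
    then show False using a r(3) by auto
  qed
  ultimately show ?thesis by (auto simp: Del_def delone_with_def)
qed

section \<open>Chaos\<close>

text \<open>Under the Cayley map the inverse of \<open>boost v\<close> is multiplication by exp
  (-v).\<close>

lemma act_inv_boost:
  assumes "w \<in> disc"
  shows "foot (act (su_inv (boost v)) w) = foot w - v" "height (act (su_inv (boost v)) w) = height w"
proof -
  define c s where "c = cosh (v/2)" and "s = sinh (v/2)"
  define N D where "N = of_real c * w - of_real s" and "D = of_real c - of_real s * w"
  have D: "den (su_inv (boost v)) w = D"
    by (simp add: den_def su_inv_def boost_def D_def c_def s_def)
  have act: "act (su_inv (boost v)) w = N / D"
    unfolding act_def D by (simp add: su_inv_def boost_def N_def c_def s_def)
  have D0: "D \<noteq> 0" using den_nonzero[of "su_inv (boost v)" w] assms D by simp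
  have cs: "c + s = exp (v/2)" "c - s = exp (- (v/2))"
    by (simp_all add: c_def s_def cosh_plus_sinh cosh_minus_sinh)
  have "1 + N / D = of_real (c - s) * (1 + w) / D" "1 - N / D = of_real (c + s) * (1 - w) / D"
    using D0 by (simp_all add: field_simps N_def) (simp_all add: D_def algebra_simps)
  then have "cmod (1 + N / D) / cmod (1 - N / D) = (exp (- (v/2)) / exp (v/2)) * (cmod (1 + w) / cmod (1 - w))"
    unfolding cs using D0 by (simp add: norm_divide norm_mult)
  also have "exp (- (v/2)) / exp (v/2) = exp (- v)" by (simp flip: exp_diff)
  finally show "foot (act (su_inv (boost v)) w) = foot w - v"
    unfolding act foot_def using norm_one_plus_minus[OF assms] by (simp add: ln_mult ln_div)
  have "Im (N * cnj D) = (c\<^sup>2 - s\<^sup>2) * Im w"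
    unfolding N_def D_def by (simp add: power2_eq_square algebra_simps)
  also have "c\<^sup>2 - s\<^sup>2 = 1" by (simp add: c_def s_def cosh_square_eq)
  finally have im: "Im (N * cnj D) = Im w" by simp
  have "Im (N / D) = Im (N * cnj D) / (cmod D)\<^sup>2"
    by (rule Im_divide_eq_cnj)
  then show "height (act (su_inv (boost v)) w) = height w"
    using one_minus_act[of "su_inv (boost v)" w] assms D0 unfolding act D height_def im by simp
qed

lemma feet_boost:
  assumes p: "p \<in> SU11" and Y: "Y \<subseteq> disc"
  shows "feet Y \<rho> (p \<odot> boost v) = translate (feet Y \<rho> p) v"
proof -
  have eq: "foot (act (su_inv (p \<odot> boost v)) y) = foot (act (su_inv p) y) - v"
    "act (su_inv (p \<odot> boost v)) y \<in> strip \<rho> \<longleftrightarrow> act (su_inv p) y \<in> strip \<rho>" if "y \<in> Y" for y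
  proof -
    have y: "y \<in> disc" using Y that by blast
    then have "act (su_inv (p \<odot> boost v)) y = act (su_inv (boost v)) (act (su_inv p) y)"
      using p by (simp add: su_inv_mult act_mult)
    then show "foot (act (su_inv (p \<odot> boost v)) y) = foot (act (su_inv p) y) - v"
      "act (su_inv (p \<odot> boost v)) y \<in> strip \<rho> \<longleftrightarrow> act (su_inv p) y \<in> strip \<rho>"
      using act_inv_boost[of "act (su_inv p) y" v] p y by (simp_all add: strip_def)
  qed
  show ?thesis
  proof (intro set_eqI)
    fix t
    have "t \<in> feet Y \<rho> (p \<odot> boost v) \<longleftrightarrow> (\<exists>y\<in>Y. t = foot (act (su_inv p) y) - v \<and> act (su_inv p) y \<in> strip \<rho>)"
      unfolding feet_def mem_Collect_eq using eq by metis
    also have "\<dots> \<longleftrightarrow> t + v \<in> feet Y \<rho> p" by (force simp: feet_def)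
    finally show "t \<in> feet Y \<rho> (p \<odot> boost v) \<longleftrightarrow> t \<in> translate (feet Y \<rho> p) v"
      by (simp add: in_translate_iff)
  qed
qed

text \<open>The equation says that the unit vector \<open>u\<^sup>2\<close> makes a prescribed angle with \<open>w\<close>.\<close>
lemma finite_rotations_with_foot:
  assumes w: "w \<in> disc" and v: "v \<noteq> 0"
  shows "finite {u. cmod u = 1 \<and> foot (act (su_inv (u, 0)) w) = v}"
proof -
  define E where "E = exp (2 * v)"
  define k where "k = (1 + (cmod w)\<^sup>2) * (E - 1)"
  \<comment> \<open>With z = cnj u^2 * w the condition |1 + z|^2 = E |1 - z|^2 reads (1 + E) (z +
    cnj z) = k. Multiplied by u^2 it is a polynomial equation of degree at most 4 in u; its middle
    coefficient -k is nonzero because v is.\<close>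
  define c :: "nat \<Rightarrow> complex" where
    "c = (\<lambda>i. if i = 0 then of_real (1 + E) * w else if i = 2 then - of_real k
        else if i = 4 then of_real (1 + E) * cnj w else 0)"
  have "E \<noteq> 1" using v by (simp add: E_def)
  moreover have "1 + (cmod w)\<^sup>2 \<noteq> 0" by (metis add_pos_nonneg less_irrefl zero_le_power2 zero_less_one)
  ultimately have "k \<noteq> 0" by (simp add: k_def)
  then have "c 2 \<noteq> 0" by (simp add: c_def)
  then have fin: "finite {u. (\<Sum>i\<le>4. c i * u ^ i) = 0}" by (auto simp: polyfun_finite_roots intro: exI[of _ 2])
  have root: "(\<Sum>i\<le>4. c i * u ^ i) = 0" if u: "cmod u = 1" and f: "foot (act (su_inv (u, 0)) w) = v" for u
  proof -
    define z where "z = (cnj u)\<^sup>2 * w"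
    have z: "act (su_inv (u, 0)) w = z"
      using act_rot[of "cnj u" w] u by (simp add: su_inv_def z_def)
    have zd: "z \<in> disc" using act_in_disc[OF su_inv_in[OF rot_in_SU11[OF u]] w] z by simp
    have P: "cmod (1 + z) > 0" "cmod (1 - z) > 0" using norm_one_plus_minus[OF zd] by auto
    then have "cmod (1 + z) / cmod (1 - z) = exp v"
      using f unfolding z foot_def by (metis divide_pos_pos exp_ln)
    then have "(cmod (1 + z))\<^sup>2 = E * (cmod (1 - z))\<^sup>2"
      using P by (simp add: field_simps power_mult_distrib E_def flip: exp_double)
    moreover have "cmod z = cmod w" using u by (simp add: z_def norm_mult norm_power)
    ultimately have "2 * Re z * (1 + E) = k"
      unfolding norm_one_plus_minus(3,4)[OF zd] k_def by (simp add: algebra_simps)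
    then have "complex_of_real (2 * Re z * (1 + E)) = of_real k" by simp
    then have zk: "of_real (1 + E) * (z + cnj z) = of_real k"
      by (simp add: complex_add_cnj mult.commute)
    have uz: "of_real (1 + E) * (u\<^sup>2 * z + u\<^sup>2 * cnj z) = of_real k * u\<^sup>2"
      unfolding zk[symmetric] by (simp add: algebra_simps)
    have uu: "u * cnj u = 1" using u by (simp add: complex_norm_square[symmetric])
    then have z1: "u\<^sup>2 * z = w" by (simp add: z_def flip: power_mult_distrib mult.assoc)
    have z2: "u\<^sup>2 * cnj z = cnj w * u ^ 4"
      by (simp add: z_def power4_eq_xxxx power2_eq_square algebra_simps)
    have "c 0 + c 1 * u + c 2 * u\<^sup>2 + c 3 * u ^ 3 + c 4 * u ^ 4 = 0"
      using uz unfolding z1 z2 by (simp add: c_def distrib_left mult.assoc diff_add_eq)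
    moreover have "(\<Sum>i\<le>4. c i * u ^ i) = c 0 + c 1 * u + c 2 * u\<^sup>2 + c 3 * u ^ 3 + c 4 * u ^ 4"
      by (simp add: eval_nat_numeral)
    ultimately show ?thesis by (simp only:)
  qed
  show ?thesis by (rule finite_subset[OF _ fin]) (use root in blast)
qed

context fuchsian_group
begin

lemma feet_lift:
  assumes x: "x \<in> disc" and q: "q \<in> lifts" and p: "p \<in> SU11"
  shows "feet (orbit \<Gamma> x) \<rho> (q \<odot> p) = feet (orbit \<Gamma> x) \<rho> p"
proof -
  have sub: "feet (orbit \<Gamma> x) \<rho> (q \<odot> p) \<subseteq> feet (orbit \<Gamma> x) \<rho> p" if q: "q \<in> lifts" and p: "p \<in> SU11" for q p
  proof
    fix t assume "t \<in> feet (orbit \<Gamma> x) \<rho> (q \<odot> p)"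
    then obtain r where r: "r \<in> lifts" "t = foot (act (su_inv (q \<odot> p)) (act r x))"
      "act (su_inv (q \<odot> p)) (act r x) \<in> strip \<rho>"
      by (auto simp: feet_def orbit_eq[OF x])
    have "act (su_inv (q \<odot> p)) (act r x) = act (su_inv p) (act (su_inv q \<odot> r) x)"
      using r q p x by (simp add: su_inv_mult act_mult lifts_SU11)
    moreover have "act (su_inv q \<odot> r) x \<in> orbit \<Gamma> x"
      using q r by (auto simp: orbit_eq[OF x] intro: lifts_mult lifts_inv)
    ultimately show "t \<in> feet (orbit \<Gamma> x) \<rho> p" using r by (auto simp: feet_def)
  qed
  show ?thesis
    using sub[OF q p] sub[OF lifts_inv[OF q], of "q \<odot> p"] q p by (simp add: lifts_SU11)
qed

end

section \<open>The orbit closure of the set of a dense geodesic\<close>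

locale dense_geodesic_setting = fuchsian_group +
  fixes x :: complex and \<rho> :: real and p :: "complex \<times> complex"
  assumes x_disc: "x \<in> disc" and rho_pos: "\<rho> > 0" and p_SU11: "p \<in> SU11"
    and dense: "dense_geodesic \<Gamma> (\<lambda>s. act p (std_geod s))"
begin

abbreviation "Y \<equiv> orbit \<Gamma> x"
abbreviation "S \<equiv> feet Y \<rho> p"

sublocale discrete_orbit Y \<rho>
  using orbit_subset_disc[OF x_disc] finite_orbit[OF x_disc] rho_pos by unfold_locales auto

lemma feet_approx:
  assumes r: "r \<in> SU11" and R: "R > 0"
  obtains v where "N_rel R (feet Y \<rho> r) (translate S v)"
proof -
  obtain p1 d where p1: "p1 \<in> SU11" "d > 0" 
    "\<And>p. p \<in> SU11 \<Longrightarrow> dist p p1 < d \<Longrightarrow> N_rel R (feet Y \<rho> r) (feet Y \<rho> p)"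
    using feet_perturbation[OF r R] by blast
  obtain q t where q: "q \<in> lifts" "dist (q \<odot> (p \<odot> boost t)) p1 < d"
    using dense_frames[OF p_SU11 dense p1(1,2)] .
  have "N_rel R (feet Y \<rho> r) (feet Y \<rho> (q \<odot> (p \<odot> boost t)))"
    using p1(3) q p_SU11 by (simp add: lifts_SU11)
  then show ?thesis
    using that feet_lift[OF x_disc q(1), of "p \<odot> boost t"] feet_boost[OF p_SU11 Y_disc] p_SU11 by simp
qed

text \<open>The constants are those of \<open>S\<close>, which puts all sets considered into the
  space where closures are taken.\<close>

lemma feet_in_Del:
  assumes "S \<in> Del \<epsilon> \<delta>" "r \<in> SU11" shows "feet Y \<rho> r \<in> Del \<epsilon> \<delta>"
  using Del_limit[OF assms(1) finite_feet_window[OF assms(2)]] feet_approx[OF assms(2)] by metis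

lemma feet_in_hull:
  assumes "S \<in> Del \<epsilon> \<delta>" "r \<in> SU11" shows "feet Y \<rho> r \<in> rubber \<epsilon> \<delta> closure_of orb S"
proof (rule in_rubber_closure[OF feet_in_Del[OF assms]])
  fix R :: real assume "R > 0"
  then obtain v where "N_rel R (feet Y \<rho> r) (translate S v)" using feet_approx[OF assms(2)] by blast
  then show "\<exists>S'\<in>orb S. S' \<in> Del \<epsilon> \<delta> \<and> N_rel R (feet Y \<rho> r) S'"
    using translate_in_Del[OF assms(1)] by (auto simp: orb_def)
qed

lemma almost_chaotic:
  assumes S: "S \<in> Del \<epsilon> \<delta>" shows "almost_chaotic_in \<epsilon> \<delta> S"
proof -
  define C where "C = rubber \<epsilon> \<delta> closure_of (orb S)"
  define X where "X = \<Union>{orb T | T. T \<in> C \<and> periodic_in \<epsilon> \<delta> T}"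
  have "translate S v \<in> rubber \<epsilon> \<delta> closure_of X" for v
  proof (rule in_rubber_closure[OF translate_in_Del[OF S]])
    fix R :: real assume R: "R > 0"
    \<comment> \<open>Each translate of \<open>S\<close> is the set of a frame, so the perturbation
      result applies to it directly.\<close>
    have pv: "p \<odot> boost v \<in> SU11" using p_SU11 by simp
    obtain p1 d where p1: "p1 \<in> SU11" "d > 0" 
      "\<And>r. r \<in> SU11 \<Longrightarrow> dist r p1 < d \<Longrightarrow> N_rel R (feet Y \<rho> (p \<odot> boost v)) (feet Y \<rho> r)"
      using feet_perturbation[OF pv R] by blast
    obtain p' q L where p': "p' \<in> SU11" "dist p' p1 < d" "q \<in> lifts" "L > 0" "q \<odot> p' = p' \<odot> boost L"
      using closed_geodesics_dense[OF p_SU11 dense p1(1,2)] .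
    define T where "T = feet Y \<rho> p'"
    have "translate T L = T"
      using feet_lift[OF x_disc p'(3,1), of \<rho>] feet_boost[OF p'(1) Y_disc, of \<rho> L] by (simp add: p'(5) T_def)
    then have "periodic_in \<epsilon> \<delta> T"
      using periodic_in_if_translate_eq feet_in_Del[OF S p'(1)] p'(4) by (simp add: T_def)
    moreover have "T \<in> C" using feet_in_hull[OF S p'(1)] by (simp add: T_def C_def)
    moreover have "T \<in> orb T" unfolding orb_def by (metis rangeI translate_0)
    ultimately have "T \<in> X" by (auto simp: X_def)
    moreover have "N_rel R (translate S v) T"
      using p1(3)[OF p'(1,2)] feet_boost[OF p_SU11 Y_disc] by (simp add: T_def)
    ultimately show "\<exists>S'\<in>X. S' \<in> Del \<epsilon> \<delta> \<and> N_rel R (translate S v) S'"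
      using feet_in_Del[OF S p'(1)] by (auto simp: T_def)
  qed
  \<comment> \<open>A closure is closed, so reaching the orbit itself suffices.\<close>
  then have "orb S \<subseteq> rubber \<epsilon> \<delta> closure_of X" by (auto simp: orb_def)
  then have "C \<subseteq> rubber \<epsilon> \<delta> closure_of X"
    unfolding C_def by (rule closure_of_minimal) simp
  then show ?thesis unfolding almost_chaotic_in_def Let_def C_def X_def .
qed

text \<open>Pass from t to a nearby point of a translate of \<open>S\<close>, shift by v there, and
  return. The total error is below the gap between t + v and a locally finite set that would omit
  it.\<close>

lemma feet_translation_invariant:
  assumes v: "translate S v = S" and r: "r \<in> SU11" and t: "t \<in> feet Y \<rho> r"
  shows "t + v \<in> feet Y \<rho> r"
proof (rule ccontr)
  assume not: "t + v \<notin> feet Y \<rho> r"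
  define A where "A = feet Y \<rho> r \<inter> {- (\<bar>t + v\<bar> + 2)..\<bar>t + v\<bar> + 2}"
  have "finite A" unfolding A_def by (rule finite_feet_window[OF r])
  moreover have "0 < \<bar>t + v - a\<bar>" if "a \<in> A" for a using not that by (auto simp: A_def)
  ultimately obtain \<eta> where \<eta>: "\<eta> > 0" "\<And>a. a \<in> A \<Longrightarrow> 0 + \<eta> \<le> \<bar>t + v - a\<bar>"
    using finite_uniform_gap[of A 0 "\<lambda>a. \<bar>t + v - a\<bar>"] by blast
  \<comment> \<open>The way there and back costs less than 2/R, which has to stay below \<eta> and
    below 1; R must also keep t and the shifted point inside the window.\<close>
  obtain R where R: "R > \<bar>t\<bar> + \<bar>v\<bar> + 1" "R > 0" "1 / R < min \<eta> 1 / 2"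
    using small_radius[of "min \<eta> 1 / 2" "\<bar>t\<bar> + \<bar>v\<bar> + 1"] \<eta>(1) by auto
  have R': "1 / R < \<eta> / 2" "1 / R < 1 / 2" using R(3) by linarith+
  obtain a where a: "N_rel R (feet Y \<rho> r) (translate S a)" using feet_approx[OF r R(2)] .
  have "\<bar>t\<bar> < R" using R(1) by linarith
  then obtain s where s: "s \<in> translate S a" "\<bar>t - s\<bar> < 1 / R" using a t unfolding N_rel_iff by blast
  have "s + v \<in> translate S a"
    using s(1) v by (metis in_translate_iff add.assoc add.commute)
  moreover have "\<bar>s + v\<bar> < R" using s(2) R(1) R'(2) by linarith
  ultimately obtain b where b: "b \<in> feet Y \<rho> r" "\<bar>s + v - b\<bar> < 1 / R" using a unfolding N_rel_iff by blast
  have "\<bar>t + v - b\<bar> < \<eta>" "\<bar>t + v - b\<bar> < 1" using s(2) b(2) R' by linarith+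
  moreover from this have "b \<in> A" using b(1) by (auto simp: A_def)
  ultimately show False using \<eta>(2)[of b] by simp
qed

text \<open>All geodesics through \<open>x\<close> contribute the foot \<open>0\<close>. If \<open>v\<close> were a period, each of them would
  have an orbit point over the parameter \<open>v\<close>; but only finitely many orbit points are close
  enough, and each of them serves finitely many directions.\<close>
lemma aperiodic_feet: "aperiodic S"
  unfolding aperiodic_def
proof (intro allI impI notI)
  fix v assume v: "v \<noteq> 0" "translate S v = S"
  obtain p0 where p0: "p0 \<in> SU11" "act p0 0 = x" using su_transitive[OF x_disc] .
  have "id \<in> \<Gamma>" using fuchsian by (simp add: fuchsian_def)
  then have xY: "x \<in> Y" unfolding orbit_def by (intro image_eqI[of x _ id]) auto
  define F where "F = near \<bar>v\<bar> (su_norm p0)"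
  have F: "finite F" using su_norm_ge_1[OF p0(1)] by (simp add: F_def finite_near)
  have "\<exists>y\<in>F. foot (act (su_inv (u, 0)) (act (su_inv p0) y)) = v" if u: "cmod u = 1" for u
  proof -
    define r where "r = p0 \<odot> (u, 0)"
    have r: "r \<in> SU11" using p0 u by (simp add: r_def rot_in_SU11)
    have inv_r: "act (su_inv r) y = act (su_inv (u, 0)) (act (su_inv p0) y)" if "y \<in> disc" for y
      using that p0 u by (simp add: r_def su_inv_mult act_mult rot_in_SU11)
    have "act (su_inv r) x = 0"
      using act_inv_act[OF p0(1), of 0] x_disc by (simp add: inv_r p0(2)) (simp add: act_def su_inv_def)
    moreover have "0 \<in> strip \<rho>" using rho_pos by (simp add: strip_def height_def)
    moreover have "foot 0 = 0" by (simp add: foot_def)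
    ultimately have "0 \<in> feet Y \<rho> r" using xY unfolding feet_def by force
    then have "0 + v \<in> feet Y \<rho> r" by (rule feet_translation_invariant[OF v(2) r])
    then obtain y where y: "y \<in> Y" "foot (act (su_inv r) y) = v" "act (su_inv r) y \<in> strip \<rho>"
      by (auto simp: feet_def)
    have "su_norm r \<le> su_norm p0" using su_norm_mult[of p0 "(u, 0)"] u by (simp add: r_def su_norm_def)
    then have "y \<in> F" unfolding F_def using r y by (intro in_near) auto
    then show ?thesis using y inv_r Y_disc by (metis subsetD)
  qed
  then have "{u. cmod u = 1} \<subseteq> (\<Union>y\<in>F. {u. cmod u = 1 \<and> foot (act (su_inv (u, 0)) (act (su_inv p0) y)) = v})"
    by blast
  moreover have "finite (\<Union>y\<in>F. {u. cmod u = 1 \<and> foot (act (su_inv (u, 0)) (act (su_inv p0) y)) = v})"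
    using F p0 Y_disc v(1) by (intro finite_UN_I finite_rotations_with_foot) (auto simp: F_def near_def)
  ultimately have "finite {u. cmod u = 1}" by (rule finite_subset)
  moreover have "cis ` {0<..<1} \<subseteq> {u. cmod u = 1}" by auto
  ultimately have "finite ({0<..<1} :: real set)" using inj_on_cis by (metis finite_imageD finite_subset)
  then show False using infinite_Ioo[of "0::real" 1] by simp
qed

lemma chaotic_if_delone: "delone S \<Longrightarrow> chaotic S"
  unfolding delone_def chaotic_def using almost_chaotic aperiodic_feet by (auto simp: Del_def)

end

section \<open>The Delone property\<close>

text \<open>With the middle point moved to 0, the Euclidean inequality |w - z| <= |w| + |z| is
  enough: its equality case evaluates exactly to cosh of the sum of the two distances.\<close>

lemma hdist_triangle:
  assumes "z1 \<in> disc" "z2 \<in> disc" "z3 \<in> disc"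
  shows "hdist z1 z3 \<le> hdist z1 z2 + hdist z2 z3"
proof -
  obtain p where p: "p \<in> SU11" "act p 0 = z2" using su_transitive[OF assms(2)] .
  have p0: "act (su_inv p) z2 = 0" using act_inv_act[OF p(1), of 0] p(2) by simp
  have cs: "cosh (hdist w 0) = (1 + (cmod w)\<^sup>2) / (1 - (cmod w)\<^sup>2)"
    "sinh (hdist w 0) = 2 * cmod w / (1 - (cmod w)\<^sup>2)" if w: "w \<in> disc" for w
  proof -
    have d: "1 - (cmod w)\<^sup>2 > 0" by (rule disc_norm_sq[OF w])
    show c: "cosh (hdist w 0) = (1 + (cmod w)\<^sup>2) / (1 - (cmod w)\<^sup>2)"
      using cosh_hdist_std[OF w, of 0] by simp
    have "(sinh (hdist w 0))\<^sup>2 = (2 * cmod w / (1 - (cmod w)\<^sup>2))\<^sup>2"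
      unfolding sinh_square_eq c using d
      by (simp add: power_divide divide_simps) (simp add: power2_eq_square algebra_simps)
    then show "sinh (hdist w 0) = 2 * cmod w / (1 - (cmod w)\<^sup>2)"
      by (rule power2_eq_imp_eq) (use d hdist_nonneg[OF w zero_in_disc] in simp_all)
  qed
  have "hdist w z \<le> hdist w 0 + hdist 0 z" if w: "w \<in> disc" and z: "z \<in> disc" for w z
  proof -
    define a b where "a = cmod w" and "b = cmod z"
    have d: "1 - a\<^sup>2 > 0" "1 - b\<^sup>2 > 0" using disc_norm_sq w z by (simp_all add: a_def b_def)
    have "cmod (w - z) \<le> a + b" using norm_triangle_ineq4 by (simp add: a_def b_def)
    then have "(cmod (w - z))\<^sup>2 \<le> (a + b)\<^sup>2" by (intro power_mono) auto
    then have "cosh (hdist w z) \<le> 1 + 2 * (a + b)\<^sup>2 / ((1 - a\<^sup>2) * (1 - b\<^sup>2))"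
      unfolding cosh_hdist[OF w z] a_def[symmetric] b_def[symmetric]
      using d by (simp add: divide_right_mono)
    also have "\<dots> = cosh (hdist w 0 + hdist z 0)"
      unfolding cosh_add cs[OF w] cs[OF z] a_def[symmetric] b_def[symmetric]
      using d by (simp add: divide_simps) (simp add: power2_eq_square algebra_simps)
    finally show ?thesis
      using hdist_nonneg[OF w z] hdist_nonneg[OF w zero_in_disc] hdist_nonneg[OF z zero_in_disc]
      by (simp add: cosh_real_nonneg_le_iff hdist_commute[of 0])
  qed
  from this[of "act (su_inv p) z1" "act (su_inv p) z3"]
  show ?thesis using hdist_act[of "su_inv p"] assms p(1) by (metis act_in_disc p0 su_inv_in)
qed

lemma unit_geodesic_std: "unit_geodesic std_geod"
proof -
  have "hdist (std_geod s) (std_geod t) = \<bar>s - t\<bar>" for s t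
  proof -
    define r where "r = tanh (s/2)"
    have r: "std_geod s = of_real r" by (simp add: std_geod_def r_def)
    have "cosh (hdist (std_geod s) (std_geod t)) = (cosh t * (1 + r\<^sup>2) - 2 * sinh t * r) / (1 - r\<^sup>2)"
      using cosh_hdist_std[OF std_geod_in_disc, of s t] by (simp add: r)
    also have "\<dots> = cosh t * ((1 + r\<^sup>2) / (1 - r\<^sup>2)) - sinh t * (2 * r / (1 - r\<^sup>2))"
      by (simp add: diff_divide_distrib mult_ac)
    also have "\<dots> = cosh (s - t)"
      using std_geod_eqs[of s] by (simp add: r_def cosh_diff mult_ac)
    finally have "cosh (hdist (std_geod s) (std_geod t)) = cosh \<bar>s - t\<bar>" by simp
    then show ?thesis
      using hdist_nonneg[OF std_geod_in_disc std_geod_in_disc, of s t]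
      by (metis abs_ge_zero arcosh_cosh_real)
  qed
  then show ?thesis by (simp add: unit_geodesic_def)
qed

lemma height_foot_if_close:
  assumes w: "w \<in> disc" and "hdist w (std_geod t) < \<rho>"
  shows "\<bar>height w\<bar> < sinh \<rho>"
proof -
  have "dist_geod w std_geod < \<rho>"
    using hdist_std_foot_le[OF w, of t] assms(2) by (simp add: dist_geod_std[OF w])
  then show ?thesis unfolding sinh_dist_geod_std[OF w, symmetric] by simp
qed

lemma (in discrete_orbit) feet_separated:
  assumes p: "p \<in> SU11" and c: "\<And>y z. y \<in> Y \<Longrightarrow> z \<in> Y \<Longrightarrow> y \<noteq> z \<Longrightarrow> c \<le> hdist y z"
    and t: "t \<in> feet Y \<rho> p" "t' \<in> feet Y \<rho> p" "t \<noteq> t'"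
  shows "c - 2 * \<rho> \<le> \<bar>t - t'\<bar>"
proof -
  let ?W = "\<lambda>y. act (su_inv p) y"
  have near: "hdist (?W y) (std_geod (foot (?W y))) \<le> \<rho>" if "y \<in> Y" "?W y \<in> strip \<rho>" for y
  proof -
    have w: "?W y \<in> disc" using p that(1) Y_disc by auto
    have "sinh (dist_geod (?W y) std_geod) \<le> sinh \<rho>"
      unfolding sinh_dist_geod_std[OF w] using that(2) by (auto simp: strip_def)
    then show ?thesis by (simp add: dist_geod_std[OF w])
  qed
  obtain y where y: "y \<in> Y" "?W y \<in> strip \<rho>" "t = foot (?W y)" using t(1) by (auto simp: feet_def)
  obtain z where z: "z \<in> Y" "?W z \<in> strip \<rho>" "t' = foot (?W z)" using t(2) by (auto simp: feet_def)
  have d: "y \<in> disc" "z \<in> disc" using y z Y_disc by auto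
  have "c \<le> hdist y z" using c y z t(3) by blast
  also have "\<dots> = hdist (?W y) (?W z)" using hdist_act[OF su_inv_in[OF p] d] by simp
  \<comment> \<open>The path descends to the geodesic, runs along it and climbs to the second
    point.\<close>
  also have "\<dots> \<le> hdist (?W y) (std_geod t) + (hdist (std_geod t) (std_geod t') + hdist (std_geod t') (?W z))"
    using hdist_triangle[of "?W y" "std_geod t" "?W z"] hdist_triangle[of "std_geod t" "std_geod t'" "?W z"] p d
    by simp
  also have "hdist (std_geod t) (std_geod t') = \<bar>t - t'\<bar>"
    using unit_geodesic_std by (simp add: unit_geodesic_def)
  also have "hdist (?W y) (std_geod t) + (\<bar>t - t'\<bar> + hdist (std_geod t') (?W z)) \<le> \<rho> + (\<bar>t - t'\<bar> + \<rho>)"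
    using near[OF y(1,2)] near[OF z(1,2)] y(3) z(3) by (simp add: hdist_commute)
  finally show ?thesis by simp
qed

lemma inj_rad_le:
  assumes "orbit \<Gamma> x \<subseteq> disc" "y \<in> orbit \<Gamma> x" "z \<in> orbit \<Gamma> x" "y \<noteq> z"
  shows "2 * inj_rad \<Gamma> x \<le> hdist y z"
proof -
  have "bdd_below {hdist y z | y z. y \<in> orbit \<Gamma> x \<and> z \<in> orbit \<Gamma> x \<and> y \<noteq> z}"
    using assms(1) by (intro bdd_belowI[of _ 0]) (auto intro!: hdist_nonneg)
  then have "Inf {hdist y z | y z. y \<in> orbit \<Gamma> x \<and> z \<in> orbit \<Gamma> x \<and> y \<noteq> z} \<le> hdist y z"
    using assms by (intro cInf_lower) auto
  then show ?thesis by (simp add: inj_rad_def)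
qed

lemma closed_SU11: "closed SU11"
  unfolding SU11_def by (intro closed_Collect_eq continuous_intros)

text \<open>By compactness: otherwise longer and longer pieces of the geodesic miss the balls, and
  translates of these pieces converge to a complete geodesic missing all balls.\<close>
lemma (in fuchsian_group) feet_relatively_dense:
  assumes x: "x \<in> disc" and rho: "\<rho> > 0" and p: "p \<in> SU11" and cocpt: "cocompact \<Gamma>"
    and hit: "\<And>k. unit_geodesic k \<Longrightarrow> \<exists>t. \<exists>g\<in>\<Gamma>. hdist (k t) (g x) < \<rho>"
  shows "\<exists>\<epsilon>>0. \<forall>y. \<exists>s\<in>feet (orbit \<Gamma> x) \<rho> p. \<bar>y - s\<bar> \<le> \<epsilon>"
proof (rule ccontr)
  assume not: "\<not> ?thesis"
  define Y where "Y = orbit \<Gamma> x"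
  have Yd: "Y \<subseteq> disc" using orbit_subset_disc[OF x] by (simp add: Y_def)
  have "\<exists>y. \<forall>s\<in>feet Y \<rho> p. \<not> \<bar>y - s\<bar> \<le> real (Suc n)" for n
    using not unfolding Y_def by (meson of_nat_0_less_iff zero_less_Suc)
  \<comment> \<open>Centres of longer and longer gaps.\<close>
  then obtain v where v: "\<And>n s. s \<in> feet Y \<rho> p \<Longrightarrow> \<bar>v n - s\<bar> > real (Suc n)" by (metis not_le)
  obtain K where K: "compact K" "K \<subseteq> disc" "(\<Union>g\<in>\<Gamma>. g ` K) = disc" using cocpt by (auto simp: cocompact_def)
  \<comment> \<open>Moving the centre of each gap to parameter 0 and its base point into K preserves
    the gap and makes the frames bounded.\<close>
  have "\<exists>r. r \<in> SU11 \<and> act r 0 \<in> K \<and> feet Y \<rho> r = translate (feet Y \<rho> p) (v n)" for n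
  proof -
    define b where "b = p \<odot> boost (v n)"
    have b: "b \<in> SU11" using p by (simp add: b_def)
    have "act b 0 \<in> disc" using b by simp
    then obtain g k where gk: "g \<in> \<Gamma>" "k \<in> K" "act b 0 = g k" using K(3) by blast
    obtain q where q: "q \<in> lifts" "g = mob (fst q) (snd q)" using lifts_surj[OF gk(1)] .
    have kd: "k \<in> disc" using gk K by auto
    then have "act b 0 = act q k" using gk q by (simp add: mob_eq_act)
    then have "act (su_inv q \<odot> b) 0 = k" using q b kd by (simp add: act_mult lifts_SU11)
    moreover have "feet Y \<rho> (su_inv q \<odot> b) = translate (feet Y \<rho> p) (v n)"
      using feet_lift[OF x lifts_inv[OF q(1)] b] feet_boost[OF p Yd] by (simp add: Y_def b_def)
    ultimately show ?thesis using gk(2) q b by (intro exI[of _ "su_inv q \<odot> b"]) (simp add: lifts_SU11)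
  qed
  then obtain r where r: "\<And>n. r n \<in> SU11" "\<And>n. act (r n) 0 \<in> K"
    "\<And>n. feet Y \<rho> (r n) = translate (feet Y \<rho> p) (v n)" by metis
  have far: "\<bar>s\<bar> > real (Suc n)" if "s \<in> feet Y \<rho> (r n)" for s n
    using v[of "s + v n" n] that by (simp add: r(3) in_translate_iff)
  obtain m where m: "m > 0" "\<And>k. k \<in> K \<Longrightarrow> m \<le> 1 - (cmod k)\<^sup>2"
  proof -
    have "\<exists>k0\<in>K. \<forall>k\<in>K. 1 - (cmod k0)\<^sup>2 \<le> 1 - (cmod k)\<^sup>2"
      using K(1) r(2) by (intro continuous_attains_inf continuous_intros) auto
    then obtain k0 where "k0 \<in> K" "\<And>k. k \<in> K \<Longrightarrow> 1 - (cmod k0)\<^sup>2 \<le> 1 - (cmod k)\<^sup>2" by blast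
    then show ?thesis using that[of "1 - (cmod k0)\<^sup>2"] disc_norm_sq K(2) by blast
  qed
  have "bounded (range r)"
  proof -
    have "norm (r n) \<le> 2 * sqrt (1 / m)" for n
    proof -
      \<comment> \<open>The base point of a frame determines |fst| by 1 - |act r 0|^2 = 1 / |fst
        r|^2.\<close>
      have "m \<le> 1 / (cmod (fst (r n)))\<^sup>2"
        using m(2)[OF r(2)[of n]] one_minus_act[OF r(1)[of n], of 0] by (simp add: den_def)
      moreover have "0 < (cmod (fst (r n)))\<^sup>2" using su_less(2)[OF r(1)[of n]] by (intro zero_less_power) linarith
      ultimately have "(cmod (fst (r n)))\<^sup>2 \<le> 1 / m" using m(1) by (simp add: field_simps)
      then have "cmod (fst (r n)) \<le> sqrt (1 / m)" by (rule real_le_rsqrt)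
      then show ?thesis
        using norm_le_su_norm[of "r n"] su_less(1)[OF r(1)[of n]] by (simp add: su_norm_def)
    qed
    then show ?thesis by (auto simp: bounded_iff)
  qed
  then obtain l f where l: "strict_mono (f :: nat \<Rightarrow> nat)" "(r \<circ> f) \<longlonglongrightarrow> l"
    using bounded_imp_convergent_subsequence by blast
  have lSU: "l \<in> SU11" using closed_sequentially[OF closed_SU11 _ l(2)] r(1) by simp
  obtain t g where tg: "g \<in> \<Gamma>" "hdist (act l (std_geod t)) (g x) < \<rho>"
    using hit[OF unit_geodesic_act[OF unit_geodesic_std lSU]] by blast
  define y where "y = g x"
  have y: "y \<in> Y" using tg by (auto simp: y_def Y_def orbit_def)
  have yd: "y \<in> disc" using y Yd by blast
  define W where "W = (\<lambda>q. act (su_inv q) y)"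
  have Wd: "W l \<in> disc" using lSU yd by (simp add: W_def)
  have "hdist (W l) (std_geod t) < \<rho>"
    using tg(2) hdist_act_std[OF lSU yd] by (simp add: W_def y_def hdist_commute)
  then have h: "\<bar>height (W l)\<bar> < sinh \<rho>" by (rule height_foot_if_close[OF Wd])
  have lim: "(\<lambda>n. W ((r \<circ> f) n)) \<longlonglongrightarrow> W l" unfolding W_def by (rule tendsto_act_inv[OF l(2) lSU yd])
  have "\<forall>\<^sub>F n in sequentially. \<bar>height (W ((r \<circ> f) n))\<bar> < sinh \<rho>"
    by (rule order_tendstoD(2)[OF tendsto_rabs[OF tendsto_height[OF lim Wd]] h])
  moreover have "\<forall>\<^sub>F n in sequentially. \<bar>foot (W ((r \<circ> f) n))\<bar> < \<bar>foot (W l)\<bar> + 1"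
    by (rule order_tendstoD(2)[OF tendsto_rabs[OF tendsto_foot[OF lim Wd]]]) simp
  moreover have "\<forall>\<^sub>F n in sequentially. \<bar>foot (W l)\<bar> + 1 < real n"
    using filterlim_real_sequentially by (simp add: filterlim_at_top_dense)
  ultimately have "\<forall>\<^sub>F n in sequentially. \<bar>height (W ((r \<circ> f) n))\<bar> < sinh \<rho>
      \<and> \<bar>foot (W ((r \<circ> f) n))\<bar> < \<bar>foot (W l)\<bar> + 1 \<and> \<bar>foot (W l)\<bar> + 1 < real n"
    by (intro eventually_conj)
  then obtain n where n: "\<bar>height (W (r (f n)))\<bar> < sinh \<rho>" "\<bar>foot (W (r (f n)))\<bar> < \<bar>foot (W l)\<bar> + 1"
    "\<bar>foot (W l)\<bar> + 1 < real n"
    using eventually_happens'[OF sequentially_bot] by fastforce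
  \<comment> \<open>The strict inequality for the limit frame survives nearby, so the point y has a
    foot inside the gap.\<close>
  have "foot (W (r (f n))) \<in> feet Y \<rho> (r (f n))"
    using y n(1) unfolding feet_def W_def strip_def by (auto simp: abs_less_iff)
  then have "real (Suc (f n)) < \<bar>foot (W (r (f n)))\<bar>" by (rule far)
  moreover have "n \<le> f n" by (rule seq_suble[OF l(1)])
  ultimately show False using n(2,3) by linarith
qed

theorem theorem3p5:
  fixes \<Gamma> :: "(complex \<Rightarrow> complex) set" and \<tau> :: "complex set"
    and \<kappa> :: "real \<Rightarrow> complex" and x :: complex and \<rho> :: real
  assumes "fuchsian \<Gamma>" and "cocompact \<Gamma>"
    and "hyp_polygon \<tau>" and "fundamental_domain \<Gamma> \<tau>"
    and "\<forall>g\<in>side_pairings \<Gamma> \<tau>. g \<circ> g \<noteq> id"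
    and "unit_geodesic \<kappa>" and "dense_geodesic \<Gamma> \<kappa>"
    and "x \<in> interior \<tau>" and "\<rho> > 0"
  shows "((\<forall>k. unit_geodesic k \<longrightarrow> (\<exists>t. \<exists>g\<in>\<Gamma>. hdist (k t) (g x) < \<rho>))
            \<and> \<rho> < inj_rad \<Gamma> x \<longrightarrow> delone (S_plus \<Gamma> \<kappa> \<rho> x))
         \<and> (delone (S_plus \<Gamma> \<kappa> \<rho> x) \<longrightarrow> chaotic (S_plus \<Gamma> \<kappa> \<rho> x))"
proof -
  have x: "x \<in> disc" using assms(4,8) interior_subset by (auto simp: fundamental_domain_def)
  obtain p where p: "p \<in> SU11" "\<kappa> = (\<lambda>t. act p (std_geod t))" using unit_geodesic_imp[OF assms(6)] .
  interpret dense_geodesic_setting \<Gamma> x \<rho> p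
    using assms x p by unfold_locales simp_all
  have S: "S_plus \<Gamma> \<kappa> \<rho> x = S"
    unfolding p(2) by (rule S_plus_eq_feet[OF p(1) assms(9) Y_disc])
  have "delone S" if hit: "\<forall>k. unit_geodesic k \<longrightarrow> (\<exists>t. \<exists>g\<in>\<Gamma>. hdist (k t) (g x) < \<rho>)"
    and inj: "\<rho> < inj_rad \<Gamma> x"
  proof -
    obtain \<epsilon> where \<epsilon>: "\<epsilon> > 0" "\<forall>y. \<exists>s\<in>S. \<bar>y - s\<bar> \<le> \<epsilon>"
      using feet_relatively_dense[OF x assms(9) p(1) assms(2)] hit by blast
    \<comment> \<open>\<open>inj_rad\<close> is half the infimum of the distances between orbit
      points, and each of the two points is at most \<rho> from its foot.\<close>
    have "2 * inj_rad \<Gamma> x - 2 * \<rho> \<le> \<bar>s - s'\<bar>" if "s \<in> S" "s' \<in> S" "s \<noteq> s'" for s s'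
      using feet_separated[OF p(1) inj_rad_le[OF Y_disc] that] .
    then have "delone_with \<epsilon> (2 * inj_rad \<Gamma> x - 2 * \<rho>) S" using \<epsilon>(2) by (simp add: delone_with_def)
    moreover have "2 * inj_rad \<Gamma> x - 2 * \<rho> > 0" using inj by simp
    ultimately show ?thesis using \<epsilon>(1) unfolding delone_def by blast
  qed
  then show ?thesis unfolding S using chaotic_if_delone by blast
qed

end
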